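(* Let $\lambda(\vartheta)$, $\vartheta\in\mathbb T^d$, be a band function of the discrete normalized Laplacian $\Delta$ on the $\mathbb Z^d$-periodic graph $\Gamma$. Suppose $\lambda$ has a minimum (respectively, maximum) at some point $\vartheta_0\in\mathbb T^d$ and that $\lambda(\vartheta_0)$ is a simple eigenvalue of $\Delta(\vartheta_0)$. Then the effective form $\mu(\omega)=\frac12\frac{\partial^2}{\partial\varepsilon^2}\lambda(\vartheta_0+\varepsilon\omega)\big|_{\varepsilon=0}$ satisfies $$|\mu(\omega)|\le \frac{T_1^2}{\rho}+T_2\qquad\text{for all }\omega\in\mathbb S^{d-1},$$ where $$T_s=\frac1s\max_{u\in V_*}\sum_{\mathbf e=(u,v)\in\mathcal A_*}\frac{\|\tau(\mathbf e)\|^s}{\sqrt{\varkappa_u\varkappa_v}},\qquad s=1,2,$$ the sum being over all oriented edges $\mathbf e\in\mathcal A_*$ starting at $u$ ($v$ denoting the end of $\mathbf e$), and $\rho=\rho(\vartheta_0)$ is the distance between $\lambda(\vartheta_0)$ and the set $\sigma(\Delta(\vartheta_0))\setminus\{\lambda(\vartheta_0)\}$.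
   Context: Graph. Let $d\ge2$ and let $\Gamma=(V,\mathcal E)$ be a connected infinite graph, possibly with loops and multiple edges, with vertex set $V$ and set $\mathcal E$ of unoriented edges. The degree $\varkappa_v$ of a vertex is the number of edges incident to it, a loop being counted twice. $\Gamma$ is $\mathbb Z^d$-periodic: it is equipped with an action of $\mathbb Z^d$ by graph automorphisms, written $v\mapsto v+m$, free on vertices; all degrees are finite; and the quotient (fundamental) graph $\Gamma_*=\Gamma/\mathbb Z^d=(V_*,\mathcal E_* )$, $V_*=V/\mathbb Z^d$, $\mathcal E_*=\mathcal E/\mathbb Z^d$, is finite. Put $\nu=\#V_*$. The degree of a vertex of $\Gamma_*$ equals that of any of its representatives in $V$. Oriented edges and indices. Each unoriented edge with endpoints $u,v$ yields two oriented edges $(u,v)$ and $(v,u)$ (also for loops); $\mathcal A$ and $\mathcal A_*$ denote the sets of oriented edges of $\Gamma$ and $\Gamma_*$ (multiple edges being distinct elements). A fundamental vertex set $V_0\subset V$ is a set of $\nu$ pairwise non-$\mathbb Z^d$-equivalent vertices; fix one. Each $v\in V$ is uniquely $v=v_0+[v]$ with $v_0\in V_0$, $[v]\in\mathbb Z^d$. The index of $\mathbf e=(u,v)\in\mathcal A$ is $\tau(\mathbf e)=[v]-[u]\in\mathbb Z^d$; it is $\mathbb Z^d$-invariant, so it defines the index $\tau(\mathbf e_* )$ of each $\mathbf e_*\in\mathcal A_*$. $\|\cdot\|$ and $\langle\cdot,\cdot\rangle$ are the Euclidean norm and inner product on $\mathbb R^d$. Laplacian. On $\ell^2(V)$, $(\Delta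 f)(v)=\frac1{\sqrt{\varkappa_v}}\sum_{(v,u)_e\in\mathcal E}\Big(\frac{f(v)}{\sqrt{\varkappa_v}}-\frac{f(u)}{\sqrt{\varkappa_u}}\Big)$, the sum being over unoriented edges at $v$, loops counted twice. It decomposes into a direct integral over $\mathbb T^d=\mathbb R^d/(2\pi\mathbb Z)^d$ with fibers the self-adjoint $\nu\times\nu$ Floquet matrices $\Delta(\vartheta)=\{\Delta_{uv}(\vartheta)\}_{u,v\in V_*}$, $$\Delta_{uv}(\vartheta)=\delta_{uv}-\frac1{\sqrt{\varkappa_u\varkappa_v}}\sum_{\mathbf e=(u,v)\in\mathcal A_*}e^{i\langle\tau(\mathbf e),\vartheta\rangle}$$ (empty sum $=0$). Band functions. If $\Delta$ has $r\ge0$ flat bands, i.e. eigenvalues of $\Delta(\vartheta)$ constant in $\vartheta$ (counted with multiplicity), they are denoted $\lambda_j$, $\nu-r<j\le\nu$; the remaining eigenvalues of $\Delta(\vartheta)$ are enumerated, with multiplicity, as $\lambda_1(\vartheta)\le\dots\le\lambda_{\nu-r}(\vartheta)$. The functions $\lambda_n(\cdot)$ are the band functions. If a band function $\lambda$ has an extremum at $\vartheta_0$ and $\lambda(\vartheta_0)$ is a simple eigenvalue of $\Delta(\vartheta_0)$, then for $\vartheta=\vartheta_0+\varepsilon\omega$, $\omega\in\mathbb S^{d-1}$ (the unit sphere of $\mathbb R^d$), $\varepsilon=|\vartheta-\vartheta_0|\to0$, one has $\lambda(\vartheta)=\lambda(\vartheta_0)+\varepsilon^2\mu(\omega)+O(\varepsilon^3)$,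 and $\mu$ is called the effective form. The distance to the empty set is taken to be $+\infty$ (so $T_1^2/\rho=0$ in that case). *)

theory Defs
  imports
    "HOL-Analysis.Analysis"
    "Jordan_Normal_Form.Char_Poly"
    "Jordan_Normal_Form.Spectral_Radius"
    "Graph_Theory.Digraph_Component"
    "Graph_Theory.Bidirected_Digraph"
begin

text \<open>
  A multigraph is represented by its oriented edges: the arcs of a digraph together with the
  fixed-point free involution \<open>arev\<close> that reverses them. An unoriented edge is a pair
  \<open>{a, arev a}\<close>, so that loops have two orientations as well.
\<close>

definition unoriented_edges :: "('v, 'e) pre_digraph \<Rightarrow> ('e \<Rightarrow> 'e) \<Rightarrow> 'e set set" where
  "unoriented_edges G arev = (\<lambda>a. {a, arev a}) ` arcs G"

text \<open>The set of endpoints of \<open>X = {a, arev a}\<close> is \<open>tail G ` X\<close>; the second summand counts loops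
  once more.\<close>

definition vertex_degree :: "('v, 'e) pre_digraph \<Rightarrow> ('e \<Rightarrow> 'e) \<Rightarrow> 'v \<Rightarrow> nat" where
  "vertex_degree G arev v =
     card {X \<in> unoriented_edges G arev. v \<in> tail G ` X} +
     card {X \<in> unoriented_edges G arev. tail G ` X = {v}}"

definition lattice_orbit :: "(int ^ 'd \<Rightarrow> 'x \<Rightarrow> 'x) \<Rightarrow> 'x \<Rightarrow> 'x set" where
  "lattice_orbit act x = range (\<lambda>m. act m x)"

text \<open>
  The action is given on oriented edges. An action on unoriented edges lifts to them, because the
  group is torsion free and acts freely on the vertices, so that no translation reverses an edge.
\<close>

locale periodic_graph = bidirected_digraph G arev
  for G :: "('v, 'e) pre_digraph" and arev :: "'e \<Rightarrow> 'e" +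
  fixes vact :: "int ^ 'd \<Rightarrow> 'v \<Rightarrow> 'v"
    and eact :: "int ^ 'd \<Rightarrow> 'e \<Rightarrow> 'e"
  assumes dim_ge_2: "CARD('d) \<ge> 2"
    and connected: "Digraph_Component.connected G"
    and infinite_verts: "infinite (verts G)"
    and finite_degrees: "\<And>v. v \<in> verts G \<Longrightarrow> finite (out_arcs G v)"
    and vact_closed: "\<And>m v. v \<in> verts G \<Longrightarrow> vact m v \<in> verts G"
    and vact_zero: "\<And>v. v \<in> verts G \<Longrightarrow> vact 0 v = v"
    and vact_add: "\<And>m n v. v \<in> verts G \<Longrightarrow> vact (m + n) v = vact m (vact n v)"
    and eact_closed: "\<And>m a. a \<in> arcs G \<Longrightarrow> eact m a \<in> arcs G"
    and eact_zero: "\<And>a. a \<in> arcs G \<Longrightarrow> eact 0 a = a"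
    and eact_add: "\<And>m n a. a \<in> arcs G \<Longrightarrow> eact (m + n) a = eact m (eact n a)"
    and tail_eact: "\<And>m a. a \<in> arcs G \<Longrightarrow> tail G (eact m a) = vact m (tail G a)"
    and head_eact: "\<And>m a. a \<in> arcs G \<Longrightarrow> head G (eact m a) = vact m (head G a)"
    and arev_eact: "\<And>m a. a \<in> arcs G \<Longrightarrow> arev (eact m a) = eact m (arev a)"
    and vact_free: "\<And>m v. v \<in> verts G \<Longrightarrow> vact m v = v \<Longrightarrow> m = 0"
    and finite_quotient_verts: "finite (lattice_orbit vact ` verts G)"
    and finite_quotient_arcs: "finite (lattice_orbit eact ` arcs G)"
begin

text \<open>The image of an orbit of arcs under \<open>tail G\<close>, \<open>head G\<close> or \<open>arev\<close> is again an orbit.\<close>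

definition quotient_graph :: "('v set, 'e set) pre_digraph" where
  "quotient_graph =
     \<lparr>verts = lattice_orbit vact ` verts G, arcs = lattice_orbit eact ` arcs G,
      tail = (\<lambda>A. tail G ` A), head = (\<lambda>A. head G ` A)\<rparr>"

definition quotient_degree :: "'v set \<Rightarrow> nat" where
  "quotient_degree = vertex_degree quotient_graph (\<lambda>A. arev ` A)"

end

text \<open>The fundamental vertex set is \<open>set vs\<close>. Its listing also orders the vertices
  \<open>lattice_orbit vact (vs ! i)\<close> of the quotient graph, i.e. the rows and columns of the Floquet
  matrices.\<close>

locale fundamental_vertex_set = periodic_graph G arev vact eact
  for G :: "('v, 'e) pre_digraph" and arev :: "'e \<Rightarrow> 'e"
    and vact :: "int ^ 'd \<Rightarrow> 'v \<Rightarrow> 'v" and eact :: "int ^ 'd \<Rightarrow> 'e \<Rightarrow> 'e" +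
  fixes vs :: "'v list"
  assumes vs_subset: "set vs \<subseteq> verts G"
    and vs_inequivalent: "distinct (map (lattice_orbit vact) vs)"
    and length_vs: "length vs = card (verts quotient_graph)"
begin

definition cell :: "'v \<Rightarrow> int ^ 'd" where
  "cell v = (THE m. \<exists>v0\<in>set vs. v = vact m v0)"

definition arc_index :: "'e \<Rightarrow> int ^ 'd" where
  "arc_index a = cell (head G a) - cell (tail G a)"

text \<open>On an orbit of arcs \<open>arc_index\<close> is constant, so \<open>the_elem\<close> picks its only value.\<close>

definition \<tau> :: "'e set \<Rightarrow> real ^ 'd" where
  "\<tau> A = (\<chi> i. real_of_int (vec_nth (the_elem (arc_index ` A)) i))"

definition floquet :: "real ^ 'd \<Rightarrow> complex Matrix.mat" where
  "floquet \<theta> = Matrix.mat (length vs) (length vs) (\<lambda>(i, j).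
     let u = lattice_orbit vact (vs ! i); v = lattice_orbit vact (vs ! j) in
     (if u = v then 1 else 0) -
     complex_of_real (1 / sqrt (real (quotient_degree u * quotient_degree v))) *
       (\<Sum>e | e \<in> arcs quotient_graph \<and> tail quotient_graph e = u \<and> head quotient_graph e = v.
          exp (\<i> * complex_of_real (inner (\<tau> e) \<theta>))))"

text \<open>The Floquet matrices are Hermitian, so \<open>Re\<close> loses nothing.\<close>

definition eigenvalues :: "real ^ 'd \<Rightarrow> real multiset" where
  "eigenvalues \<theta> = image_mset Re (proots (char_poly (floquet \<theta>)))"

text \<open>\<open>Inf\<close> is the intersection of multisets: the multiplicity of \<open>x\<close> as a flat band is the
  minimum over all \<open>\<theta>\<close> of its multiplicity as an eigenvalue.\<close>

definition flat_bands :: "real multiset" where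
  "flat_bands = Inf (range eigenvalues)"

text \<open>The bands are numbered from 1 to \<open>length vs\<close>, the flat ones coming last.\<close>

definition band :: "nat \<Rightarrow> real ^ 'd \<Rightarrow> real" where
  "band n \<theta> =
     (sorted_list_of_multiset (eigenvalues \<theta> - flat_bands) @ sorted_list_of_multiset flat_bands)
       ! (n - 1)"

text \<open>Functions on the torus are functions on \<open>real ^ 'd\<close> that are \<open>2\<pi>\<close>-periodic in each
  coordinate; band functions are, since \<open>floquet\<close> is.\<close>

definition band_functions :: "(real ^ 'd \<Rightarrow> real) set" where
  "band_functions = band ` {1..length vs}"

definition simple_eigenvalue :: "real ^ 'd \<Rightarrow> real \<Rightarrow> bool" where
  "simple_eigenvalue \<theta> x \<longleftrightarrow> order (complex_of_real x) (char_poly (floquet \<theta>)) = 1"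

text \<open>The infimum over the empty set is \<open>\<infinity>\<close> in \<^typ>\<open>ereal\<close>.\<close>

definition spectral_gap :: "real ^ 'd \<Rightarrow> real \<Rightarrow> ereal" where
  "spectral_gap \<theta> x =
     (INF z \<in> spectrum (floquet \<theta>) - {complex_of_real x}. ereal (dist (complex_of_real x) z))"

definition T :: "nat \<Rightarrow> real" where
  "T s = 1 / real s *
     Max ((\<lambda>u. \<Sum>e | e \<in> arcs quotient_graph \<and> tail quotient_graph e = u.
             norm (\<tau> e) ^ s /
               sqrt (real (quotient_degree u * quotient_degree (head quotient_graph e))))
          ` verts quotient_graph)"

end

definition effective_form :: "(real ^ 'd \<Rightarrow> real) \<Rightarrow> real ^ 'd \<Rightarrow> real ^ 'd \<Rightarrow> real" where
  "effective_form lam \<theta>0 \<omega> = 1 / 2 * (deriv ^^ 2) (\<lambda>\<epsilon>. lam (\<theta>0 + \<epsilon> *\<^sub>R \<omega>)) 0"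

end

theory Submission
  imports
    Defs
    "HOL-Analysis.Function_Metric"
    "HOL-Complex_Analysis.Cauchy_Integral_Formula"
    "HOL-Probability.Characteristic_Functions"
    "Jordan_Normal_Form.Schur_Decomposition"
begin

text \<open>
  Fix a unit vector \<open>\<omega>\<close> and follow the band along the line \<open>\<theta>0 + t *\<^sub>R \<omega>\<close>. Let \<open>A(t)\<close> be the Floquet
  matrix there, \<open>f(t)\<close> the band function, \<open>E(t) = A(t) - A(0)\<close>, and \<open>u\<close> a unit eigenvector of
  \<open>A(0)\<close> for the simple eigenvalue \<open>f(0)\<close>.

  The heart of the proof is a non-asymptotic form of second order perturbation theory
  (\<open>perturbed_eigenvalue_estimate\<close>). Split an eigenvector \<open>w\<close> of \<open>A(t)\<close> into a multiple of \<open>u\<close> and a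
  part orthogonal to \<open>u\<close>. On the orthogonal complement of \<open>u\<close> the matrix \<open>A(0) - f(t)\<close> is bounded
  below by almost the spectral gap \<open>\<rho>\<close>, so the orthogonal part of \<open>w\<close> is of size \<open>\<parallel>E(t)\<parallel> / \<rho>\<close>; testing
  the eigenvalue equation against \<open>u\<close> then shows that \<open>f(t) - f(0)\<close> differs from \<open>\<langle>E(t) u, u\<rangle>\<close> by
  roughly \<open>\<parallel>E(t)\<parallel>\<^sup>2 / \<rho>\<close>.

  The constants \<open>T 1\<close> and \<open>T 2\<close> are what the Schur test gives for matrices whose entries are bounded by
  the weighted sums of \<open>\<parallel>\<tau>(e)\<parallel>\<close> and \<open>\<parallel>\<tau>(e)\<parallel>\<^sup>2 / 2\<close> over the arcs between two vertices
  (\<open>moment_schur_test\<close>). With \<open>\<bar>exp (\<i> x) - 1\<bar> \<le> \<bar>x\<bar>\<close> one gets \<open>\<parallel>E(t)\<parallel> \<le> \<bar>t\<bar> T 1\<close>, and with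
  \<open>\<bar>exp (\<i> x) - 1 - \<i> x\<bar> \<le> x\<^sup>2 / 2\<close> one gets \<open>\<langle>E(t) u, u\<rangle> = t h + R(t)\<close> where \<open>\<bar>R(t)\<bar> \<le> t\<^sup>2 T 2\<close>.
  At an extremum \<open>f'(0) = 0\<close>, hence \<open>h = 0\<close>, and \<open>\<bar>f(t) - f(0)\<bar> / t\<^sup>2\<close> is bounded by a quantity that
  tends to \<open>(T 1)\<^sup>2 / \<rho> + T 2\<close>. The left side tends to \<open>\<bar>f''(0)\<bar> / 2\<close>, the absolute value of the
  effective form.

  It remains to see that \<open>f\<close> has two derivatives at \<open>0\<close>. The ordered list of the roots of a real-rooted
  polynomial depends continuously on the polynomial (\<open>continuous_sorted_real_roots\<close>), so band functions are
  continuous; and a continuous branch of simple roots can be differentiated implicitly, as often as the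
  coefficients can (\<open>simple_root_branch_twice_differentiable\<close>). The coefficients of the characteristic
  polynomial of \<open>A(t)\<close> extend to entire functions of \<open>t\<close>.
\<close>

section \<open>The spectral theorem for Hermitian matrices\<close>

definition hermitian_mat :: "nat \<Rightarrow> complex Matrix.mat \<Rightarrow> bool" where
  "hermitian_mat n A \<longleftrightarrow> A \<in> carrier_mat n n \<and> (\<forall>i<n. \<forall>j<n. A $$ (i, j) = cnj (A $$ (j, i)))"

lemma index_mult_mat_sum:
  fixes X Y :: "complex Matrix.mat"
  assumes "X \<in> carrier_mat n n" "Y \<in> carrier_mat n n" "i < n" "j < n"
  shows "(X * Y) $$ (i, j) = (\<Sum>k<n. X $$ (i, k) * Y $$ (k, j))"
  using assms by (simp add: times_mat_def scalar_prod_def lessThan_atLeast0)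

lemma trace_mult_commute:
  fixes X Y :: "complex Matrix.mat"
  assumes "X \<in> carrier_mat n n" "Y \<in> carrier_mat n n"
  shows "(\<Sum>i<n. (X * Y) $$ (i, i)) = (\<Sum>i<n. (Y * X) $$ (i, i))"
proof -
  have "(\<Sum>i<n. (X * Y) $$ (i, i)) = (\<Sum>i<n. \<Sum>k<n. X $$ (i, k) * Y $$ (k, i))"
    using assms by (simp add: index_mult_mat_sum del: index_mult_mat)
  also have "\<dots> = (\<Sum>k<n. \<Sum>i<n. Y $$ (k, i) * X $$ (i, k))"
    by (subst sum.swap) (simp add: mult.commute)
  also have "\<dots> = (\<Sum>i<n. (Y * X) $$ (i, i))"
    using assms by (simp add: index_mult_mat_sum del: index_mult_mat)
  finally show ?thesis .
qed

text \<open>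
  Similar matrices have the same trace, and a Schur form carries the eigenvalues on its diagonal.
\<close>

lemma trace_eq_sum_eigenvalues:
  fixes A :: "complex Matrix.mat"
  assumes A: "A \<in> carrier_mat n n"
  obtains es where "length es = n" "set es = spectrum A" "(\<Sum>i<n. A $$ (i, i)) = sum_list es"
proof -
  obtain es where es: "char_poly A = (\<Prod>e\<leftarrow>es. [:- e, 1:])" "length es = n"
    using char_poly_factorized[OF A] by blast
  obtain B P Q where schur: "schur_decomposition A es = (B, P, Q)"
    by (cases "schur_decomposition A es") auto
  from schur_decomposition[OF A es(1) schur]
  have sim: "similar_mat_wit A B P Q" and diag: "diag_mat B = es" by auto
  note w = similar_mat_witD2[OF A sim]
  have "(\<Sum>i<n. A $$ (i, i)) = (\<Sum>i<n. (P * (B * Q)) $$ (i, i))"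
    using w by (simp add: assoc_mult_mat[of P n n B n Q n])
  also have "\<dots> = (\<Sum>i<n. ((B * Q) * P) $$ (i, i))"
    by (rule trace_mult_commute) (use w in auto)
  also have "(B * Q) * P = B"
    using w by (simp add: assoc_mult_mat[of B n n Q n P n])
  also have "(\<Sum>i<n. B $$ (i, i)) = sum_list (diag_mat B)"
    using w by (simp add: diag_mat_def interv_sum_list_conv_sum_set_nat lessThan_atLeast0)
  finally have tr: "(\<Sum>i<n. A $$ (i, i)) = sum_list es" using diag by simp
  have "set es = spectrum A"
    unfolding spectrum_root_char_poly[OF A] es(1)
    by (auto simp: poly_prod_list prod_list_zero_iff)
  with es(2) tr that show ?thesis by blast
qed

text \<open>
  From here on vectors are functions of the index, so that inner products are plain sums. This lemma
  and its converse \<open>entries_eigenvalue\<close> connect them with the spectrum.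
\<close>

lemma eigenvalue_entries:
  fixes A :: "complex Matrix.mat"
  assumes A: "A \<in> carrier_mat n n" and "e \<in> spectrum A"
  obtains w where "\<And>i. i < n \<Longrightarrow> (\<Sum>l<n. A $$ (i, l) * w l) = e * w i" "\<exists>i<n. w i \<noteq> 0"
proof -
  from assms obtain v where v: "v \<in> carrier_vec n" "v \<noteq> 0\<^sub>v n" "A *\<^sub>v v = e \<cdot>\<^sub>v v"
    unfolding spectrum_def eigenvalue_def eigenvector_def by auto
  have "(\<Sum>l<n. A $$ (i, l) * vec_index v l) = e * vec_index v i" if "i < n" for i
  proof -
    have "(\<Sum>l<n. A $$ (i, l) * vec_index v l) = vec_index (A *\<^sub>v v) i"
      using that A v(1) by (simp add: scalar_prod_def lessThan_atLeast0)
    then show ?thesis using v that by simp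
  qed
  moreover have "\<exists>i<n. vec_index v i \<noteq> 0"
  proof (rule ccontr)
    assume "\<not> ?thesis"
    then have "v = 0\<^sub>v n" using v(1) by (intro eq_vecI) auto
    with v show False by simp
  qed
  ultimately show ?thesis using that by blast
qed

lemma entries_eigenvalue:
  fixes A :: "complex Matrix.mat"
  assumes A: "A \<in> carrier_mat n n"
    and w: "\<And>i. i < n \<Longrightarrow> (\<Sum>l<n. A $$ (i, l) * w l) = e * w i" "\<exists>i<n. w i \<noteq> 0"
  shows "e \<in> spectrum A"
proof -
  let ?v = "Matrix.vec n w"
  have "A *\<^sub>v ?v = e \<cdot>\<^sub>v ?v"
    using A w(1) by (intro eq_vecI) (auto simp: scalar_prod_def lessThan_atLeast0)
  moreover have "?v \<noteq> 0\<^sub>v n"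
    using w(2) by (metis index_vec index_zero_vec(1))
  ultimately show ?thesis
    using A unfolding spectrum_def eigenvalue_def eigenvector_def by (intro CollectI exI[of _ ?v]) auto
qed

lemma hermitian_form_swap:
  assumes "hermitian_mat n A"
  shows "(\<Sum>i<n. (\<Sum>l<n. A $$ (i, l) * x l) * cnj (y i)) = (\<Sum>i<n. x i * cnj (\<Sum>l<n. A $$ (i, l) * y l))"
proof -
  have h: "A $$ (i, l) * x l * cnj (y i) = x l * (cnj (A $$ (l, i)) * cnj (y i))" if "i < n" "l < n" for i l
  proof -
    have "A $$ (i, l) = cnj (A $$ (l, i))"
      using assms that unfolding hermitian_mat_def by blast
    then show ?thesis by (simp only: mult_ac)
  qed
  have "(\<Sum>i<n. (\<Sum>l<n. A $$ (i, l) * x l) * cnj (y i)) = (\<Sum>l<n. \<Sum>i<n. A $$ (i, l) * x l * cnj (y i))"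
    unfolding sum_distrib_right by (rule sum.swap)
  also have "\<dots> = (\<Sum>i<n. x i * cnj (\<Sum>l<n. A $$ (i, l) * y l))"
    unfolding cnj_sum sum_distrib_left complex_cnj_mult
    by (intro sum.cong refl h) auto
  finally show ?thesis .
qed

lemma sum_cmod_sq_pos:
  fixes n :: nat
  assumes "\<exists>i<n. w i \<noteq> (0::complex)"
  shows "(\<Sum>i<n. (cmod (w i))\<^sup>2) > 0"
proof -
  obtain i where i: "i < n" "w i \<noteq> 0" using assms by blast
  have "0 < (cmod (w i))\<^sup>2" using i by simp
  also have "\<dots> \<le> (\<Sum>i<n. (cmod (w i))\<^sup>2)" using i by (intro member_le_sum[of i "{..<n}" "\<lambda>i. (cmod (w i))\<^sup>2"]) auto
  finally show ?thesis .
qed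

lemma sum_mult_cnj: "(\<Sum>i\<in>S. w i * cnj (w i)) = complex_of_real (\<Sum>i\<in>S. (cmod (w i))\<^sup>2)"
  by (simp only: of_real_sum complex_norm_square)

lemma hermitian_eigenvalue_real:
  assumes A: "hermitian_mat n A" and e: "e \<in> spectrum A"
  shows "e = complex_of_real (Re e)"
proof -
  from A have Ac: "A \<in> carrier_mat n n" by (simp add: hermitian_mat_def)
  obtain w where w: "\<And>i. i < n \<Longrightarrow> (\<Sum>l<n. A $$ (i, l) * w l) = e * w i" "\<exists>i<n. w i \<noteq> 0"
    using eigenvalue_entries[OF Ac e] by metis
  have "(\<Sum>i<n. (e * w i) * cnj (w i)) = (\<Sum>i<n. w i * cnj (e * w i))"
    using hermitian_form_swap[OF A, of w w] w(1) by simp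
  then have "e * of_real (\<Sum>i<n. (cmod (w i))\<^sup>2) = cnj e * of_real (\<Sum>i<n. (cmod (w i))\<^sup>2)"
    unfolding sum_mult_cnj[symmetric] by (simp add: sum_distrib_left mult_ac)
  moreover have "complex_of_real (\<Sum>i<n. (cmod (w i))\<^sup>2) \<noteq> 0"
    using sum_cmod_sq_pos[OF w(2)] by (simp only: of_real_eq_0_iff)
  ultimately have "e = cnj e" by (rule mult_right_cancel[THEN iffD1, rotated])
  then have "Im e = Im (cnj e)" by (rule arg_cong)
  then have "Im e = 0" by simp
  then show ?thesis by (simp add: complex_eq_iff)
qed

text \<open>
  \<open>u j i\<close> is the coordinate number \<open>i < n\<close> of the vector number \<open>j < m\<close>.
\<close>

definition orthonormal :: "nat \<Rightarrow> nat \<Rightarrow> (nat \<Rightarrow> nat \<Rightarrow> complex) \<Rightarrow> bool" where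
  "orthonormal n m u \<longleftrightarrow>
     (\<forall>j<m. \<forall>k<m. (\<Sum>i<n. u j i * cnj (u k i)) = (if j = k then 1 else 0))"

text \<open>
  Deflation: adding the matrix \<open>\<Sum>j<m. (s - d j) u\<^sub>j u\<^sub>j\<^sup>*\<close> turns all the known eigenvalues into \<open>s\<close> and
  changes nothing on the orthogonal complement of the \<open>u\<^sub>j\<close>. If the trace of the new matrix is not \<open>n s\<close>,
  then it has an eigenvalue other than \<open>s\<close>. Its eigenvectors are orthogonal to all \<open>u\<^sub>j\<close>, and hence
  they are eigenvectors of \<open>A\<close>.
\<close>

lemma hermitian_next_eigenvector:
  assumes A: "hermitian_mat n A" and m: "m < n" and on: "orthonormal n m u"
    and eig: "\<And>j i. j < m \<Longrightarrow> i < n \<Longrightarrow> (\<Sum>l<n. A $$ (i, l) * u j l) = complex_of_real (d j) * u j i"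
  shows "\<exists>w e. (\<forall>i<n. (\<Sum>l<n. A $$ (i, l) * w l) = complex_of_real e * w i) \<and>
    (\<Sum>i<n. w i * cnj (w i)) = 1 \<and> (\<forall>j<m. (\<Sum>i<n. w i * cnj (u j i)) = 0)"
proof -
  from A have Ac: "A \<in> carrier_mat n n" by (simp add: hermitian_mat_def)
  define \<alpha> where "\<alpha> = (\<Sum>i<n. A $$ (i, i)) - (\<Sum>j<m. complex_of_real (d j))"
  \<comment> \<open>\<open>Re \<alpha> / (n - m)\<close> is the one value for which the trace of \<open>C\<close> can equal \<open>n s\<close>; adding 1 avoids it.\<close>
  define s :: real where "s = Re \<alpha> / (real n - real m) + 1"
  have s: "\<alpha> + of_nat m * of_real s \<noteq> of_nat n * of_real s"
  proof
    assume "\<alpha> + of_nat m * of_real s = of_nat n * of_real s"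
    then have "Re \<alpha> + real m * s = real n * s" by (simp add: complex_eq_iff)
    then have "Re \<alpha> = (real n - real m) * s" by (simp add: algebra_simps)
    also have "\<dots> = Re \<alpha> + (real n - real m)"
      using m unfolding s_def by (simp add: field_simps)
    finally show False using m by simp
  qed
  define C where "C = Matrix.mat n n (\<lambda>(i, l). A $$ (i, l)
      + (\<Sum>j<m. of_real (s - d j) * u j i * cnj (u j l)))"
  have Cc: "C \<in> carrier_mat n n" by (simp add: C_def)
  have unit: "(\<Sum>i<n. u j i * cnj (u j i)) = 1" if "j < m" for j
    using on that unfolding orthonormal_def by simp
  have "(\<Sum>i<n. C $$ (i, i)) = (\<Sum>i<n. A $$ (i, i)) + (\<Sum>j<m. \<Sum>i<n. of_real (s - d j) * u j i * cnj (u j i))"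
    unfolding C_def by (simp add: sum.distrib) (rule sum.swap)
  also have "(\<Sum>j<m. \<Sum>i<n. of_real (s - d j) * u j i * cnj (u j i)) = (\<Sum>j<m. complex_of_real (s - d j))"
    by (intro sum.cong refl) (simp only: mult.assoc sum_distrib_left[symmetric] unit lessThan_iff mult_1_right)
  finally have tr: "(\<Sum>i<n. C $$ (i, i)) = \<alpha> + of_nat m * of_real s"
    by (simp add: \<alpha>_def sum_subtractf)
  obtain es where es: "length es = n" "set es = spectrum C" "(\<Sum>i<n. C $$ (i, i)) = sum_list es"
    using trace_eq_sum_eigenvalues[OF Cc] by metis
  have "\<exists>e\<in>set es. e \<noteq> of_real s"
  proof (rule ccontr)
    assume "\<not> ?thesis"
    then have "map (\<lambda>x. x) es = map (\<lambda>_. of_real s) es" by (intro map_cong) auto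
    then have "sum_list es = of_nat n * of_real s" using es(1) by (simp add: sum_list_triv map_replicate_const sum_list_replicate)
    with s tr es show False by simp
  qed
  then obtain e where e: "e \<in> spectrum C" "e \<noteq> of_real s" using es by blast
  obtain w where w: "\<And>i. i < n \<Longrightarrow> (\<Sum>l<n. C $$ (i, l) * w l) = e * w i" "\<exists>i<n. w i \<noteq> 0"
    using eigenvalue_entries[OF Cc e(1)] by metis
  define c where "c j = (\<Sum>l<n. w l * cnj (u j l))" for j
  have Cw: "(\<Sum>l<n. C $$ (i, l) * w l) = (\<Sum>l<n. A $$ (i, l) * w l) + (\<Sum>j<m. of_real (s - d j) * c j * u j i)"
    if "i < n" for i
  proof -
    have "(\<Sum>l<n. C $$ (i, l) * w l) = (\<Sum>l<n. A $$ (i, l) * w l)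
        + (\<Sum>l<n. \<Sum>j<m. of_real (s - d j) * u j i * cnj (u j l) * w l)"
      using that unfolding C_def by (simp add: sum.distrib sum_distrib_right distrib_right)
    also have "(\<Sum>l<n. \<Sum>j<m. of_real (s - d j) * u j i * cnj (u j l) * w l)
        = (\<Sum>j<m. of_real (s - d j) * c j * u j i)"
      unfolding c_def by (subst sum.swap) (simp add: sum_distrib_left sum_distrib_right mult_ac)
    finally show ?thesis .
  qed
  have c0: "c k = 0" if k: "k < m" for k
  proof -
    have "(\<Sum>i<n. (\<Sum>l<n. A $$ (i, l) * w l) * cnj (u k i)) = (\<Sum>i<n. w i * cnj (of_real (d k) * u k i))"
      unfolding hermitian_form_swap[OF A] using eig[OF k] by simp
    also have "\<dots> = of_real (d k) * c k" unfolding c_def by (simp add: sum_distrib_left mult_ac)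
    finally have 1: "(\<Sum>i<n. (\<Sum>l<n. A $$ (i, l) * w l) * cnj (u k i)) = of_real (d k) * c k" .
    have "(\<Sum>i<n. (\<Sum>j<m. of_real (s - d j) * c j * u j i) * cnj (u k i))
        = (\<Sum>j<m. of_real (s - d j) * c j * (\<Sum>i<n. u j i * cnj (u k i)))"
      unfolding sum_distrib_right sum_distrib_left by (subst sum.swap) (simp add: mult_ac)
    also have "\<dots> = (\<Sum>j<m. of_real (s - d j) * c j * (if j = k then 1 else 0))"
      using on k unfolding orthonormal_def by (intro sum.cong) auto
    also have "\<dots> = of_real (s - d k) * c k" using k by (simp add: if_distrib cong: if_cong)
    finally have 2: "(\<Sum>i<n. (\<Sum>j<m. of_real (s - d j) * c j * u j i) * cnj (u k i)) = of_real (s - d k) * c k" .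
    have "e * c k = (\<Sum>i<n. (e * w i) * cnj (u k i))" by (simp add: c_def sum_distrib_left mult_ac)
    also have "\<dots> = (\<Sum>i<n. ((\<Sum>l<n. A $$ (i, l) * w l) + (\<Sum>j<m. of_real (s - d j) * c j * u j i)) * cnj (u k i))"
      using w(1) Cw by (intro sum.cong) auto
    also have "\<dots> = of_real s * c k" using 1 2 by (simp add: distrib_right sum.distrib algebra_simps)
    finally show ?thesis using e(2) by simp
  qed
  have Aw: "(\<Sum>l<n. A $$ (i, l) * w l) = e * w i" if "i < n" for i
    using Cw[OF that] w(1)[OF that] c0 by simp
  have "e \<in> spectrum A" by (rule entries_eigenvalue[OF Ac Aw w(2)])
  then have er: "e = of_real (Re e)" by (rule hermitian_eigenvalue_real[OF A])
  define N where "N = sqrt (\<Sum>i<n. (cmod (w i))\<^sup>2)"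
  have N: "N > 0" "N\<^sup>2 = (\<Sum>i<n. (cmod (w i))\<^sup>2)"
    using sum_cmod_sq_pos[OF w(2)] by (auto simp: N_def)
  show ?thesis
  proof (intro exI[of _ "\<lambda>i. w i / of_real N"] exI[of _ "Re e"] conjI allI impI)
    fix i assume "i < n"
    then show "(\<Sum>l<n. A $$ (i, l) * (w l / of_real N)) = complex_of_real (Re e) * (w i / of_real N)"
      using Aw unfolding er[symmetric] by (simp add: sum_divide_distrib[symmetric])
  next
    have "(\<Sum>i<n. w i / of_real N * cnj (w i / of_real N)) = (\<Sum>i<n. w i * cnj (w i)) / (of_real N)\<^sup>2"
      by (simp add: sum_divide_distrib power2_eq_square)
    also have "(\<Sum>i<n. w i * cnj (w i)) = of_real (N\<^sup>2)"
      unfolding N(2) by (rule sum_mult_cnj)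
    finally show "(\<Sum>i<n. w i / of_real N * cnj (w i / of_real N)) = 1" using N(1) by simp
  next
    fix j assume "j < m"
    then show "(\<Sum>i<n. w i / of_real N * cnj (u j i)) = 0"
      using c0 by (simp add: c_def sum_divide_distrib[symmetric])
  qed
qed

theorem hermitian_eigenbasis:
  assumes A: "hermitian_mat n A"
  obtains u d where "orthonormal n n u"
    "\<And>j i. j < n \<Longrightarrow> i < n \<Longrightarrow> (\<Sum>l<n. A $$ (i, l) * u j l) = complex_of_real (d j) * u j i"
proof -
  have "\<exists>u d. orthonormal n m u \<and>
      (\<forall>j<m. \<forall>i<n. (\<Sum>l<n. A $$ (i, l) * u j l) = complex_of_real (d j) * u j i)" if "m \<le> n" for m
    using that
  proof (induction m)
    case 0
    show ?case by (simp add: orthonormal_def)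
  next
    case (Suc m)
    then obtain u d where ud: "orthonormal n m u"
      "\<And>j i. j < m \<Longrightarrow> i < n \<Longrightarrow> (\<Sum>l<n. A $$ (i, l) * u j l) = complex_of_real (d j) * u j i"
      by auto
    obtain w e where w: "\<forall>i<n. (\<Sum>l<n. A $$ (i, l) * w l) = complex_of_real e * w i"
      "(\<Sum>i<n. w i * cnj (w i)) = 1" "\<forall>j<m. (\<Sum>i<n. w i * cnj (u j i)) = 0"
      using hermitian_next_eigenvector[OF A Suc_le_lessD[OF Suc.prems] ud] by blast
    have w': "(\<Sum>i<n. u j i * cnj (w i)) = 0" if "j < m" for j
    proof -
      have "(\<Sum>i<n. u j i * cnj (w i)) = cnj (\<Sum>i<n. w i * cnj (u j i))" by (simp add: mult.commute)
      then show ?thesis using w(3) that by simp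
    qed
    show ?case
    proof (intro exI conjI)
      show "orthonormal n (Suc m) (u(m := w))"
        using ud(1) w(2,3) w' unfolding orthonormal_def by (auto simp: less_Suc_eq)
      show "\<forall>j<Suc m. \<forall>i<n. (\<Sum>l<n. A $$ (i, l) * (u(m := w)) j l) = complex_of_real ((d(m := e)) j) * (u(m := w)) j i"
        using ud(2) w(1) by (auto simp: less_Suc_eq)
    qed
  qed
  from this[of n] show ?thesis using that by blast
qed

text \<open>
  A right inverse of a square matrix is also a left inverse.
\<close>

lemma orthonormal_complete:
  assumes on: "orthonormal n n u" and "i < n" "l < n"
  shows "(\<Sum>j<n. u j i * cnj (u j l)) = (if i = l then 1 else 0)"
proof -
  define U where "U = Matrix.mat n n (\<lambda>(j, i). u j i)"
  define V where "V = Matrix.mat n n (\<lambda>(i, j). cnj (u j i))"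
  have c: "U \<in> carrier_mat n n" "V \<in> carrier_mat n n" by (auto simp: U_def V_def)
  have "U * V = 1\<^sub>m n"
  proof (rule eq_matI)
    fix i j assume "i < dim_row (1\<^sub>m n)" "j < dim_col (1\<^sub>m n)"
    then have ij: "i < n" "j < n" by auto
    show "(U * V) $$ (i, j) = 1\<^sub>m n $$ (i, j)"
      unfolding index_mult_mat_sum[OF c ij] using ij on
      by (simp add: U_def V_def orthonormal_def)
  qed (use c in auto)
  then have "V * U = 1\<^sub>m n" by (rule mat_mult_left_right_inverse[OF c])
  then have "(V * U) $$ (l, i) = 1\<^sub>m n $$ (l, i)" by simp
  then show ?thesis unfolding index_mult_mat_sum[OF c(2,1) assms(3,2)] using assms(2,3)
    by (auto simp: U_def V_def mult.commute split: if_splits)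
qed

lemma char_poly_eigenbasis:
  assumes A: "A \<in> carrier_mat n n" and on: "orthonormal n n u"
    and eig: "\<And>j i. j < n \<Longrightarrow> i < n \<Longrightarrow> (\<Sum>l<n. A $$ (i, l) * u j l) = d j * u j i"
  shows "char_poly A = (\<Prod>j<n. [:- d j, 1:])"
proof -
  define P where "P = Matrix.mat n n (\<lambda>(i, j). u j i)"
  define Q where "Q = Matrix.mat n n (\<lambda>(j, i). cnj (u j i))"
  define D where "D = Matrix.mat n n (\<lambda>(i, j). if i = j then d j else 0)"
  have c: "P \<in> carrier_mat n n" "Q \<in> carrier_mat n n" "D \<in> carrier_mat n n"
    by (auto simp: P_def Q_def D_def)
  have PQ: "P * Q = 1\<^sub>m n"
  proof (rule eq_matI)
    fix i j assume "i < dim_row (1\<^sub>m n)" "j < dim_col (1\<^sub>m n)"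
    then have ij: "i < n" "j < n" by auto
    show "(P * Q) $$ (i, j) = 1\<^sub>m n $$ (i, j)"
      unfolding index_mult_mat_sum[OF c(1,2) ij] using ij orthonormal_complete[OF on]
      by (simp add: P_def Q_def)
  qed (use c in auto)
  then have QP: "Q * P = 1\<^sub>m n" by (rule mat_mult_left_right_inverse[OF c(1,2)])
  have AP: "A * P = P * D"
  proof (rule eq_matI)
    fix i j assume "i < dim_row (P * D)" "j < dim_col (P * D)"
    then have ij: "i < n" "j < n" using c by auto
    show "(A * P) $$ (i, j) = (P * D) $$ (i, j)"
      unfolding index_mult_mat_sum[OF A c(1) ij] index_mult_mat_sum[OF c(1,3) ij]
      using ij eig[OF ij(2,1)] by (simp add: P_def D_def if_distrib[of "\<lambda>x. _ * x"] mult.commute[of "d j"] cong: if_cong)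
  qed (use A c in auto)
  have "A = A * (P * Q)" using A PQ by simp
  also have "\<dots> = P * D * Q" using A c AP by (simp add: assoc_mult_mat[of A n n P n Q n, symmetric])
  finally have "similar_mat_wit A D P Q" using similar_mat_witI[OF PQ QP _ A c(3,1,2)] by blast
  then have "char_poly A = char_poly D" by (intro char_poly_similar) (auto simp: similar_mat_def)
  also have "\<dots> = (\<Prod>a\<leftarrow>diag_mat D. [:- a, 1:])"
    by (rule char_poly_upper_triangular[OF c(3)]) (auto simp: D_def)
  also have "diag_mat D = map d [0..<n]"
    unfolding diag_mat_def using c by (intro map_cong) (auto simp: D_def)
  also have "(\<Prod>a\<leftarrow>map d [0..<n]. [:- a, 1:]) = (\<Prod>j<n. [:- d j, 1:])"
    using prod.distinct_set_conv_list[of "[0..<n]" "\<lambda>j. [:- d j, 1:]"]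
    by (simp add: comp_def lessThan_atLeast0)
  finally show ?thesis .
qed

section \<open>Perturbation of a simple eigenvalue\<close>

definition cinner :: "nat \<Rightarrow> (nat \<Rightarrow> complex) \<Rightarrow> (nat \<Rightarrow> complex) \<Rightarrow> complex" where
  "cinner n x y = (\<Sum>i<n. x i * cnj (y i))"

definition cnorm :: "nat \<Rightarrow> (nat \<Rightarrow> complex) \<Rightarrow> real" where
  "cnorm n x = L2_set (\<lambda>i. cmod (x i)) {..<n}"

lemma cnorm_nonneg: "0 \<le> cnorm n x"
  by (simp add: cnorm_def)

lemma cnorm_sq: "(cnorm n x)\<^sup>2 = (\<Sum>i<n. (cmod (x i))\<^sup>2)"
  by (simp add: cnorm_def L2_set_def sum_nonneg)

lemma cinner_self: "cinner n x x = complex_of_real ((cnorm n x)\<^sup>2)"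
  unfolding cinner_def cnorm_sq by (rule sum_mult_cnj)

lemma cinner_Cauchy_Schwarz: "cmod (cinner n x y) \<le> cnorm n x * cnorm n y"
proof -
  have "cmod (cinner n x y) \<le> (\<Sum>i<n. \<bar>cmod (x i)\<bar> * \<bar>cmod (y i)\<bar>)"
    unfolding cinner_def by (rule order_trans[OF norm_sum]) (simp add: norm_mult)
  also have "\<dots> \<le> cnorm n x * cnorm n y"
    unfolding cnorm_def by (rule L2_set_mult_ineq)
  finally show ?thesis .
qed

lemma cnorm_triangle: "cnorm n (\<lambda>i. x i + y i) \<le> cnorm n x + cnorm n y"
proof -
  have "cnorm n (\<lambda>i. x i + y i) \<le> L2_set (\<lambda>i. cmod (x i) + cmod (y i)) {..<n}"
    unfolding cnorm_def by (intro L2_set_mono norm_triangle_ineq norm_ge_zero)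
  also have "\<dots> \<le> cnorm n x + cnorm n y"
    unfolding cnorm_def by (rule L2_set_triangle_ineq)
  finally show ?thesis .
qed

lemma cnorm_scale: "cnorm n (\<lambda>i. c * x i) = cmod c * cnorm n x"
  unfolding cnorm_def by (simp add: norm_mult L2_set_right_distrib)

lemma cnorm_eq_0: "cnorm n x = 0 \<Longrightarrow> i < n \<Longrightarrow> x i = 0"
  unfolding cnorm_def by (simp add: L2_set_eq_0_iff)

lemma cinner_diff_left: "cinner n (\<lambda>i. x i - y i) z = cinner n x z - cinner n y z"
  by (simp add: cinner_def left_diff_distrib sum_subtractf)

lemma cinner_scale_left: "cinner n (\<lambda>i. c * x i) z = c * cinner n x z"
  by (simp add: cinner_def sum_distrib_left mult_ac)

lemma orthonormal_cinner:
  "orthonormal n m u \<Longrightarrow> j < m \<Longrightarrow> k < m \<Longrightarrow> cinner n (u j) (u k) = (if j = k then 1 else 0)"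
  by (simp add: orthonormal_def cinner_def)

lemma orthonormal_cnorm:
  assumes "orthonormal n m u" "k < m"
  shows "cnorm n (u k) = 1"
proof -
  have "complex_of_real ((cnorm n (u k))\<^sup>2) = 1"
    using orthonormal_cinner[OF assms(1) assms(2) assms(2)] unfolding cinner_self by simp
  then have "(cnorm n (u k))\<^sup>2 = 1" by (simp only: of_real_eq_1_iff)
  then show ?thesis using cnorm_nonneg[of n "u k"] by (simp add: power2_eq_1_iff)
qed

lemma parseval:
  assumes on: "orthonormal n n u"
  shows "(\<Sum>j<n. (cmod (cinner n w (u j)))\<^sup>2) = (cnorm n w)\<^sup>2"
proof -
  have "complex_of_real (\<Sum>j<n. (cmod (cinner n w (u j)))\<^sup>2)
      = (\<Sum>j<n. cinner n w (u j) * cnj (cinner n w (u j)))"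
    by (rule sum_mult_cnj[symmetric])
  also have "\<dots> = (\<Sum>j<n. \<Sum>i<n. \<Sum>l<n. w i * cnj (w l) * (u j l * cnj (u j i)))"
    unfolding cinner_def cnj_sum sum_product by (simp add: mult_ac)
  also have "\<dots> = (\<Sum>i<n. \<Sum>l<n. \<Sum>j<n. w i * cnj (w l) * (u j l * cnj (u j i)))"
    by (subst sum.swap, subst (2) sum.swap) (rule refl)
  also have "\<dots> = (\<Sum>i<n. \<Sum>l<n. w i * cnj (w l) * (if l = i then 1 else 0))"
    unfolding sum_distrib_left[symmetric]
    by (intro sum.cong refl arg_cong2[of _ _ _ _ "(*)"] orthonormal_complete[OF on]) auto
  also have "\<dots> = complex_of_real ((cnorm n w)\<^sup>2)"
    unfolding cinner_self[symmetric] cinner_def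
    by (simp add: if_distrib[of "\<lambda>x. _ * x"] cong: if_cong)
  finally show ?thesis by (simp only: of_real_eq_iff)
qed

text \<open>
  Factor \<open>\<bar>E i l\<bar>\<close> as \<open>sqrt \<bar>E i l\<bar> * sqrt \<bar>E i l\<bar>\<close> in the Cauchy-Schwarz inequality: one factor
  is controlled by the row sums, and the other by the column sums after the order of summation is exchanged.
\<close>

lemma schur_test:
  fixes E :: "nat \<Rightarrow> nat \<Rightarrow> complex"
  assumes row: "\<And>i. i < n \<Longrightarrow> (\<Sum>l<n. cmod (E i l)) \<le> M"
    and col: "\<And>l. l < n \<Longrightarrow> (\<Sum>i<n. cmod (E i l)) \<le> M"
    and M: "0 \<le> M"
  shows "cnorm n (\<lambda>i. \<Sum>l<n. E i l * x l) \<le> M * cnorm n x"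
proof (rule power2_le_imp_le)
  have row2: "(cmod (\<Sum>l<n. E i l * x l))\<^sup>2 \<le> M * (\<Sum>l<n. cmod (E i l) * (cmod (x l))\<^sup>2)" if "i < n" for i
  proof -
    let ?a = "\<lambda>l. sqrt (cmod (E i l))" and ?b = "\<lambda>l. sqrt (cmod (E i l)) * cmod (x l)"
    have "cmod (\<Sum>l<n. E i l * x l) \<le> (\<Sum>l<n. ?a l * ?b l)"
      by (rule order_trans[OF norm_sum]) (simp add: norm_mult mult.assoc[symmetric])
    then have "(cmod (\<Sum>l<n. E i l * x l))\<^sup>2 \<le> (\<Sum>l<n. ?a l * ?b l)\<^sup>2"
      by (intro power_mono) auto
    also have "\<dots> \<le> (\<Sum>l<n. (?a l)\<^sup>2) * (\<Sum>l<n. (?b l)\<^sup>2)"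
      by (rule Cauchy_Schwarz_ineq_sum)
    also have "\<dots> = (\<Sum>l<n. cmod (E i l)) * (\<Sum>l<n. cmod (E i l) * (cmod (x l))\<^sup>2)"
      by (simp add: power_mult_distrib)
    also have "\<dots> \<le> M * (\<Sum>l<n. cmod (E i l) * (cmod (x l))\<^sup>2)"
      by (intro mult_right_mono row that sum_nonneg) auto
    finally show ?thesis .
  qed
  have "(cnorm n (\<lambda>i. \<Sum>l<n. E i l * x l))\<^sup>2 \<le> (\<Sum>i<n. M * (\<Sum>l<n. cmod (E i l) * (cmod (x l))\<^sup>2))"
    unfolding cnorm_sq by (intro sum_mono row2) auto
  also have "\<dots> = M * (\<Sum>l<n. (\<Sum>i<n. cmod (E i l)) * (cmod (x l))\<^sup>2)"
    unfolding sum_distrib_left[symmetric] sum_distrib_right by (subst sum.swap) (rule refl)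
  also have "\<dots> \<le> M * (\<Sum>l<n. M * (cmod (x l))\<^sup>2)"
    by (intro mult_left_mono M sum_mono mult_right_mono col) auto
  also have "\<dots> = (M * cnorm n x)\<^sup>2"
    unfolding power_mult_distrib cnorm_sq sum_distrib_left[symmetric] by (simp add: power2_eq_square)
  finally show "(cnorm n (\<lambda>i. \<Sum>l<n. E i l * x l))\<^sup>2 \<le> (M * cnorm n x)\<^sup>2" .
qed (use M cnorm_nonneg in auto)

text \<open>
  Write \<open>w = c u\<^sub>k + y\<close> with \<open>y\<close> orthogonal to \<open>u\<^sub>k\<close>. The coordinates of the eigenvalue equation in the
  basis \<open>u\<close> are \<open>(x - d j) \<langle>w, u\<^sub>j\<rangle> = \<langle>E w, u\<^sub>j\<rangle>\<close>. Those with \<open>j \<noteq> k\<close> give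
  \<open>(r - \<bar>x - d k\<bar>) \<parallel>y\<parallel> \<le> \<parallel>E w\<parallel> \<le> \<eta> (\<bar>c\<bar> + \<parallel>y\<parallel>)\<close>, so that \<open>\<parallel>y\<parallel>\<close> is at most \<open>\<eta> \<bar>c\<bar>\<close> over the
  denominator below. The one with \<open>j = k\<close> reads \<open>(x - d k - \<langle>E u\<^sub>k, u\<^sub>k\<rangle>) c = \<langle>E y, u\<^sub>k\<rangle>\<close>, which is at
  most \<open>\<eta> \<parallel>y\<parallel>\<close>. Keeping \<open>\<eta>\<close> in the denominator avoids normalising \<open>w\<close>.
\<close>

theorem perturbed_eigenvalue_estimate:
  assumes A: "hermitian_mat n A" and on: "orthonormal n n u"
    and eig: "\<And>j i. j < n \<Longrightarrow> i < n \<Longrightarrow> (\<Sum>l<n. A $$ (i, l) * u j l) = complex_of_real (d j) * u j i"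
    and k: "k < n" and gap: "\<And>j. j < n \<Longrightarrow> j \<noteq> k \<Longrightarrow> r \<le> \<bar>d j - d k\<bar>"
    and E: "\<And>x. cnorm n (\<lambda>i. \<Sum>l<n. E i l * x l) \<le> \<eta> * cnorm n x"
    and w: "\<And>i. i < n \<Longrightarrow> (\<Sum>l<n. (A $$ (i, l) + E i l) * w l) = complex_of_real x * w i" "\<exists>i<n. w i \<noteq> 0"
    and small: "\<bar>x - d k\<bar> + \<eta> < r" and \<eta>: "0 \<le> \<eta>"
  shows "cmod (complex_of_real (x - d k) - cinner n (\<lambda>i. \<Sum>l<n. E i l * u k l) (u k))
     \<le> \<eta>\<^sup>2 / (r - \<bar>x - d k\<bar> - \<eta>)"
proof -
  define ap where "ap y = (\<lambda>i. \<Sum>l<n. E i l * y l)" for y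
  define c where "c j = cinner n w (u j)" for j
  define y where "y i = w i - c k * u k i" for i
  define X where "X = cnorm n y"
  define D where "D = r - \<bar>x - d k\<bar> - \<eta>"
  have D: "D > 0" using small by (simp add: D_def)
  have X0: "0 \<le> X" by (simp add: X_def cnorm_nonneg)
  have uk: "cnorm n (u k) = 1"
    by (rule orthonormal_cnorm[OF on k])
  have g: "cinner n (ap w) (u j) = of_real (x - d j) * c j" if j: "j < n" for j
  proof -
    have "cinner n (ap w) (u j) = (\<Sum>i<n. (of_real x * w i - (\<Sum>l<n. A $$ (i, l) * w l)) * cnj (u j i))"
      unfolding cinner_def
    proof (intro sum.cong refl)
      fix i assume "i \<in> {..<n}"
      then have "of_real x * w i = (\<Sum>l<n. A $$ (i, l) * w l) + ap w i"
        using w(1)[of i] by (simp add: ap_def distrib_right sum.distrib)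
      then show "ap w i * cnj (u j i) = (of_real x * w i - (\<Sum>l<n. A $$ (i, l) * w l)) * cnj (u j i)"
        by simp
    qed
    also have "\<dots> = of_real x * c j - (\<Sum>i<n. (\<Sum>l<n. A $$ (i, l) * w l) * cnj (u j i))"
      by (simp add: left_diff_distrib sum_subtractf c_def cinner_def sum_distrib_left mult.assoc)
    also have "(\<Sum>i<n. (\<Sum>l<n. A $$ (i, l) * w l) * cnj (u j i)) = (\<Sum>i<n. w i * cnj (of_real (d j) * u j i))"
      unfolding hermitian_form_swap[OF A] using eig[OF j] by simp
    also have "\<dots> = of_real (d j) * c j"
      by (simp add: c_def cinner_def sum_distrib_left mult_ac)
    finally show ?thesis by (simp add: algebra_simps)
  qed
  have yc: "cinner n y (u j) = (if j = k then 0 else c j)" if "j < n" for j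
    unfolding y_def cinner_diff_left cinner_scale_left using orthonormal_cinner[OF on k that]
    by (auto simp: c_def)
  have "((r - \<bar>x - d k\<bar>) * X)\<^sup>2 = (\<Sum>j<n. ((r - \<bar>x - d k\<bar>) * cmod (cinner n y (u j)))\<^sup>2)"
    unfolding X_def power_mult_distrib parseval[OF on, of y, symmetric] sum_distrib_left ..
  also have "\<dots> \<le> (\<Sum>j<n. (cmod (cinner n (ap w) (u j)))\<^sup>2)"
  proof (rule sum_mono)
    fix j assume "j \<in> {..<n}"
    then have j: "j < n" by simp
    show "((r - \<bar>x - d k\<bar>) * cmod (cinner n y (u j)))\<^sup>2 \<le> (cmod (cinner n (ap w) (u j)))\<^sup>2"
    proof (cases "j = k")
      case True
      then show ?thesis using yc[OF j] by simp
    next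
      case False
      then have "r - \<bar>x - d k\<bar> \<le> \<bar>x - d j\<bar>" using gap[OF j] by linarith
      then show ?thesis
        unfolding yc[OF j] g[OF j] norm_mult norm_of_real using False small \<eta>
        by (intro power_mono) (auto intro: mult_right_mono)
    qed
  qed
  also have "\<dots> = (cnorm n (ap w))\<^sup>2" by (rule parseval[OF on])
  finally have "(r - \<bar>x - d k\<bar>) * X \<le> cnorm n (ap w)"
    by (rule power2_le_imp_le[OF _ cnorm_nonneg])
  also have "\<dots> \<le> \<eta> * cnorm n w" unfolding ap_def by (rule E)
  also have "\<dots> \<le> \<eta> * (cmod (c k) + X)"
  proof (rule mult_left_mono[OF _ \<eta>])
    have "cnorm n w = cnorm n (\<lambda>i. c k * u k i + y i)" by (simp add: y_def)
    also have "\<dots> \<le> cmod (c k) + X"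
      using cnorm_triangle[of n "\<lambda>i. c k * u k i" y] by (simp add: cnorm_scale uk X_def)
    finally show "cnorm n w \<le> cmod (c k) + X" .
  qed
  finally have DX: "D * X \<le> \<eta> * cmod (c k)" by (simp add: D_def algebra_simps)
  have ck: "cmod (c k) > 0"
  proof (rule ccontr)
    assume "\<not> ?thesis"
    then have c0: "c k = 0" by simp
    with DX D X0 have "X = 0" by (metis linorder_not_less mult_pos_pos mult_zero_right norm_zero order_le_less)
    then have "w i = 0" if "i < n" for i using cnorm_eq_0[of n y i] that c0 by (simp add: X_def y_def)
    with w(2) show False by blast
  qed
  let ?h = "cinner n (ap (u k)) (u k)"
  have "ap y = (\<lambda>i. ap w i - c k * ap (u k) i)"
    by (simp add: ap_def y_def right_diff_distrib sum_subtractf sum_distrib_left mult_ac)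
  then have "cinner n (ap y) (u k) = (of_real (x - d k) - ?h) * c k"
    unfolding cinner_diff_left cinner_scale_left g[OF k] by (simp add: cinner_diff_left cinner_scale_left g[OF k] algebra_simps)
  then have "cmod (of_real (x - d k) - ?h) * cmod (c k) = cmod (cinner n (ap y) (u k))"
    by (simp add: norm_mult)
  also have "\<dots> \<le> cnorm n (ap y)" using cinner_Cauchy_Schwarz[of n "ap y" "u k"] uk by simp
  also have "\<dots> \<le> \<eta> * X" unfolding ap_def X_def by (rule E)
  also have "\<dots> \<le> \<eta> * (\<eta> * cmod (c k) / D)"
    using DX D \<eta> by (intro mult_left_mono) (auto simp: field_simps)
  also have "\<dots> = \<eta>\<^sup>2 / D * cmod (c k)" by (simp add: power2_eq_square)
  finally show ?thesis using ck unfolding D_def ap_def by (simp only: mult_le_cancel_right)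
qed

section \<open>Continuity of ordered real roots\<close>

lemma proots_real_linear_factors:
  fixes h :: "nat \<Rightarrow> real"
  shows "proots (\<Prod>j<N. [:- complex_of_real (h j), 1:]) = image_mset complex_of_real (mset (map h [0..<N]))"
proof -
  have "proots (\<Prod>j<N. [:- complex_of_real (h j), 1:]) = (\<Sum>j<N. {# complex_of_real (h j) #})"
    by (subst proots_prod) auto
  also have "\<dots> = image_mset complex_of_real (mset (map h [0..<N]))"
    by (induction N) auto
  finally show ?thesis .
qed

text \<open>
  Infinitely many values determine a polynomial, hence its roots. The points \<open>k + \<i>\<close> are chosen because
  real roots stay at distance at least 1 from them.
\<close>

lemma sorted_nth_eq_if_prod_eq:
  fixes f g :: "nat \<Rightarrow> real"
  assumes "\<And>i j. i \<le> j \<Longrightarrow> j < N \<Longrightarrow> f i \<le> f j" "\<And>i j. i \<le> j \<Longrightarrow> j < N \<Longrightarrow> g i \<le> g j"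
    and eq: "\<And>k::nat. (\<Prod>j<N. of_nat k + \<i> - complex_of_real (f j)) = (\<Prod>j<N. of_nat k + \<i> - complex_of_real (g j))"
    and "j < N"
  shows "f j = g j"
proof -
  define p where "p h = (\<Prod>j<N. [:- complex_of_real (h j), 1:])" for h :: "nat \<Rightarrow> real"
  have pv: "poly (p h) (of_nat k + \<i>) = (\<Prod>j<N. of_nat k + \<i> - complex_of_real (h j))" for h k
    by (simp add: p_def poly_prod add.commute)
  have "p f = p g"
  proof (rule ccontr)
    assume "p f \<noteq> p g"
    then have "finite {z. poly (p f - p g) z = 0}" by (intro poly_roots_finite) simp
    moreover have "range (\<lambda>k::nat. of_nat k + \<i>) \<subseteq> {z. poly (p f - p g) z = 0}"
      using eq by (auto simp: pv)
    ultimately have "finite (range (\<lambda>k::nat. of_nat k + \<i>))" by (rule rev_finite_subset)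
    moreover have "inj (\<lambda>k::nat. of_nat k + \<i> :: complex)" by (auto intro: injI)
    ultimately show False using finite_imageD infinite_UNIV_nat by blast
  qed
  then have "image_mset complex_of_real (mset (map f [0..<N])) = image_mset complex_of_real (mset (map g [0..<N]))"
    unfolding p_def by (simp only: proots_real_linear_factors[symmetric])
  then have "image_mset Re (image_mset complex_of_real (mset (map f [0..<N])))
     = image_mset Re (image_mset complex_of_real (mset (map g [0..<N])))" by (rule arg_cong)
  then have "mset (map f [0..<N]) = mset (map g [0..<N])"
    by (simp add: multiset.map_comp comp_def)
  moreover have "sorted (map h [0..<N])" if "\<And>i j. i \<le> j \<Longrightarrow> j < N \<Longrightarrow> h i \<le> h j" for h :: "nat \<Rightarrow> real"
    using that by (simp add: sorted_iff_nth_mono)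
  ultimately have "map f [0..<N] = map g [0..<N]"
    using assms(1,2) by (metis properties_for_sort sorted_sort_id)
  then show ?thesis using \<open>j < N\<close> by (simp add: map_eq_conv)
qed

lemma compact_sorted_box:
  "compact {f :: nat \<Rightarrow> real. (\<forall>j. f j \<in> (if j < N then {-M..M} else {0})) \<and> (\<forall>i j. i \<le> j \<and> j < N \<longrightarrow> f i \<le> f j)}"
proof -
  let ?K = "\<lambda>j. if j < N then {-M..M::real} else {0}"
  have "compactin (product_topology (\<lambda>_::nat. euclidean) UNIV) (PiE UNIV ?K)"
    by (subst compactin_PiE) auto
  then have "compact (PiE UNIV ?K)"
    by (simp add: euclidean_product_topology)
  moreover have "closed {f :: nat \<Rightarrow> real. \<forall>i j. i \<le> j \<and> j < N \<longrightarrow> f i \<le> f j}"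
    by (intro closed_Collect_all closed_Collect_imp closed_Collect_le continuous_on_product_coordinates) auto
  ultimately have "compact (PiE UNIV ?K \<inter> {f. \<forall>i j. i \<le> j \<and> j < N \<longrightarrow> f i \<le> f j})"
    by (rule compact_Int_closed)
  moreover have "PiE UNIV ?K \<inter> {f. \<forall>i j. i \<le> j \<and> j < N \<longrightarrow> f i \<le> f j}
      = {f. (\<forall>j. f j \<in> ?K j) \<and> (\<forall>i j. i \<le> j \<and> j < N \<longrightarrow> f i \<le> f j)}"
    by (simp add: set_eq_iff PiE_UNIV_domain Pi_iff)
  ultimately show ?thesis by simp
qed

text \<open>
  The map \<open>\<Phi>\<close> from ordered tuples of roots to the values of the monic polynomial at the points \<open>k + \<i>\<close> is
  continuous and injective, so its inverse is continuous on the image of every compact set of tuples. Locally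
  in \<open>\<theta>\<close> the roots stay in such a set: all the factors of the value at \<open>\<i>\<close> have absolute value at least 1,
  so each root is bounded by this value. As \<open>k\<close> ranges over a countable set, the values live in a metrizable,
  in particular Hausdorff, space.
\<close>

theorem continuous_sorted_real_roots:
  fixes E :: "'a::t2_space \<Rightarrow> real multiset"
  assumes size: "\<And>\<theta>. size (E \<theta>) = N"
    and cont: "\<And>k::nat. continuous_on UNIV (\<lambda>\<theta>. \<Prod>x\<in>#E \<theta>. of_nat k + \<i> - complex_of_real x)"
    and j: "j < N"
  shows "continuous_on UNIV (\<lambda>\<theta>. sorted_list_of_multiset (E \<theta>) ! j)"
proof -
  define F where "F \<theta> = (\<lambda>j. if j < N then sorted_list_of_multiset (E \<theta>) ! j else 0)" for \<theta>
  define \<Phi> where "\<Phi> f = (\<lambda>k::nat. \<Prod>j<N. of_nat k + \<i> - complex_of_real (f j))" for f :: "nat \<Rightarrow> real"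
  have len: "length (sorted_list_of_multiset (E \<theta>)) = N" for \<theta>
    using size[of \<theta>] by (metis mset_sorted_list_of_multiset size_mset)
  have Fval: "\<Phi> (F \<theta>) k = (\<Prod>x\<in>#E \<theta>. of_nat k + \<i> - complex_of_real x)" for \<theta> k
  proof -
    let ?l = "sorted_list_of_multiset (E \<theta>)" and ?h = "\<lambda>x. of_nat k + \<i> - complex_of_real x"
    have "(\<Prod>x\<in>#E \<theta>. ?h x) = prod_list (map ?h ?l)"
      by (metis mset_map mset_sorted_list_of_multiset prod_mset_prod_list)
    also have "\<dots> = (\<Prod>j<N. ?h (?l ! j))"
      by (simp add: prod.list_conv_set_nth len lessThan_atLeast0)
    finally show ?thesis by (simp add: \<Phi>_def F_def)
  qed
  have Fmono: "F \<theta> i \<le> F \<theta> j" if "i \<le> j" "j < N" for \<theta> i j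
    using that sorted_sorted_list_of_multiset[of "E \<theta>"] len[of \<theta>]
    by (simp add: F_def sorted_iff_nth_mono)
  have "continuous (at \<theta>0) (\<lambda>\<theta>. F \<theta> j)" for \<theta>0
  proof -
    define M where "M = cmod (\<Phi> (F \<theta>0) 0) + 1"
    define U where "U = {\<theta>. cmod (\<Phi> (F \<theta>) 0) < M}"
    define S where "S = {f :: nat \<Rightarrow> real. (\<forall>j. f j \<in> (if j < N then {-M..M} else {0}))
        \<and> (\<forall>i j. i \<le> j \<and> j < N \<longrightarrow> f i \<le> f j)}"
    have contF: "continuous_on UNIV (\<lambda>\<theta>. \<Phi> (F \<theta>))"
      by (intro continuous_on_coordinatewise_then_product) (simp only: Fval cont)
    have "continuous_on UNIV (\<lambda>\<theta>. \<Phi> (F \<theta>) 0)" by (simp only: Fval cont)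
    then have U: "open U" "\<theta>0 \<in> U"
      unfolding U_def M_def by (auto intro!: open_Collect_less continuous_intros)
    have FS: "F \<theta> \<in> S" if "\<theta> \<in> U" for \<theta>
    proof -
      have "\<bar>F \<theta> i\<bar> \<le> M" if i: "i < N" for i
      proof -
        have "\<bar>F \<theta> i\<bar> \<le> cmod (\<i> - complex_of_real (F \<theta> i))"
          using abs_Re_le_cmod[of "\<i> - complex_of_real (F \<theta> i)"] by simp
        also have "\<dots> = (\<Prod>j\<in>{i}. cmod (\<i> - complex_of_real (F \<theta> j)))" by simp
        also have "\<dots> \<le> (\<Prod>j<N. cmod (\<i> - complex_of_real (F \<theta> j)))"
        proof (rule prod_mono2)
          fix b show "1 \<le> cmod (\<i> - complex_of_real (F \<theta> b))"
            using abs_Im_le_cmod[of "\<i> - complex_of_real (F \<theta> b)"] by simp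
        qed (use i in auto)
        also have "\<dots> = cmod (\<Phi> (F \<theta>) 0)" by (simp add: \<Phi>_def prod_norm)
        also have "\<dots> \<le> M" using \<open>\<theta> \<in> U\<close> by (simp add: U_def)
        finally show ?thesis .
      qed
      then show ?thesis using Fmono[of _ _ \<theta>] by (auto simp: S_def F_def abs_le_iff minus_le_iff)
    qed
    have "inj_on \<Phi> S"
    proof (rule inj_onI)
      fix f g assume fg: "f \<in> S" "g \<in> S" "\<Phi> f = \<Phi> g"
      have "f j = g j" for j
      proof (cases "j < N")
        case True
        show ?thesis
          by (rule sorted_nth_eq_if_prod_eq[of N f g]) (use fg True in \<open>auto simp: S_def \<Phi>_def fun_eq_iff\<close>)
      next
        case False
        then show ?thesis using fg by (auto simp: S_def dest!: spec[of _ j])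
      qed
      then show "f = g" by blast
    qed
    moreover have "continuous_on S \<Phi>"
      unfolding \<Phi>_def
      by (intro continuous_on_coordinatewise_then_product continuous_intros
          continuous_on_subset[OF continuous_on_product_coordinates]) auto
    ultimately have inv: "continuous_on (\<Phi> ` S) (inv_into S \<Phi>)"
      using compact_sorted_box unfolding S_def by (intro continuous_on_inv) auto
    have "continuous_on U (\<lambda>\<theta>. inv_into S \<Phi> (\<Phi> (F \<theta>)))"
      by (rule continuous_on_compose2[OF inv continuous_on_subset[OF contF]]) (use FS in auto)
    moreover have "inv_into S \<Phi> (\<Phi> (F \<theta>)) = F \<theta>" if "\<theta> \<in> U" for \<theta>
      using inv_into_f_f[OF \<open>inj_on \<Phi> S\<close> FS[OF that]] .
    ultimately have "continuous_on U F" by (simp cong: continuous_on_cong)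
    then have "continuous_on U (\<lambda>\<theta>. F \<theta> j)" by (rule continuous_on_product_then_coordinatewise)
    then show ?thesis using U by (simp add: continuous_on_eq_continuous_at)
  qed
  then have "continuous_on UNIV (\<lambda>\<theta>. F \<theta> j)" by (simp add: continuous_on_eq_continuous_at)
  then show ?thesis using j by (simp add: F_def)
qed

section \<open>Differentiating a branch of simple roots\<close>

text \<open>
  The polynomial in \<open>f t\<close> minus its value with \<open>f t\<close> replaced by \<open>f s\<close> has the factor \<open>f t - f s\<close>; the
  cofactor \<open>q\<close> is continuous and its value at \<open>s\<close> is the derivative of the polynomial at its root. Dividing
  the root equations by \<open>t - s\<close> and by \<open>q t\<close> gives the limit, so only continuity of \<open>f\<close> has to be known in
  advance.
\<close>

lemma root_branch_has_derivative:
  fixes C :: "nat \<Rightarrow> complex \<Rightarrow> complex" and f :: "real \<Rightarrow> real"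
  assumes C: "\<And>k. k \<le> N \<Longrightarrow> (C k has_field_derivative C' k) (at (complex_of_real s))"
    and root: "\<And>t. (\<Sum>k\<le>N. C k (of_real t) * of_real (f t) ^ k) = 0"
    and cont: "isCont f s"
    and simple: "(\<Sum>k\<le>N. C k (of_real s) * (of_nat k * of_real (f s) ^ (k - 1))) \<noteq> 0"
  shows "(f has_real_derivative
     Re (- (\<Sum>k\<le>N. C' k * of_real (f s) ^ k) / (\<Sum>k\<le>N. C k (of_real s) * (of_nat k * of_real (f s) ^ (k - 1))))) (at s)"
proof -
  define a where "a = complex_of_real (f s)"
  define q where "q t = (\<Sum>k\<le>N. C k (of_real t) * (\<Sum>i<k. a ^ (k - Suc i) * of_real (f t) ^ i))" for t
  have contC: "isCont (\<lambda>t. C k (complex_of_real t)) s" if "k \<le> N" for k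
    by (rule continuous_at_compose[of s complex_of_real "C k", unfolded comp_def])
      (auto intro!: DERIV_isCont[OF C[OF that]])
  have "isCont q s"
    unfolding q_def using cont by (intro continuous_intros contC) auto
  then have q_lim: "(q \<longlongrightarrow> q s) (at s)" by (simp add: isCont_def)
  have "(\<Sum>i<k. a ^ (k - Suc i) * a ^ i) = of_nat k * a ^ (k - 1)" for k
  proof -
    have "(\<Sum>i<k. a ^ (k - Suc i) * a ^ i) = (\<Sum>i<k. a ^ (k - 1))"
      by (intro sum.cong refl) (simp add: power_add[symmetric])
    then show ?thesis by simp
  qed
  then have q_s: "q s = (\<Sum>k\<le>N. C k (of_real s) * (of_nat k * of_real (f s) ^ (k - 1)))"
    by (simp add: q_def a_def)
  have eq: "of_real (f t - f s) * q t = - (\<Sum>k\<le>N. (C k (of_real t) - C k (of_real s)) * a ^ k)" for t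
  proof -
    have "of_real (f t - f s) * q t = (\<Sum>k\<le>N. C k (of_real t) * (of_real (f t) ^ k - a ^ k))"
      unfolding power_diff_sumr2[of "of_real (f t)" _ a] q_def by (simp add: sum_distrib_left a_def mult_ac)
    also have "\<dots> = - (\<Sum>k\<le>N. C k (of_real t) * a ^ k)"
      using root[of t] by (simp add: right_diff_distrib sum_subtractf)
    also have "(\<Sum>k\<le>N. C k (of_real t) * a ^ k) = (\<Sum>k\<le>N. (C k (of_real t) - C k (of_real s)) * a ^ k)"
      using root[of s] by (simp add: left_diff_distrib sum_subtractf a_def)
    finally show ?thesis .
  qed
  have quot: "((\<lambda>t. (C k (of_real t) - C k (of_real s)) / of_real (t - s)) \<longlongrightarrow> C' k) (at s)" if "k \<le> N" for k
  proof -
    have "((\<lambda>z. (C k z - C k (of_real s)) / (z - of_real s)) \<longlongrightarrow> C' k) (at (of_real s))"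
      using C[OF that] by (simp add: has_field_derivative_iff)
    moreover have "filterlim complex_of_real (at (of_real s)) (at s)"
      by (intro filterlim_atI tendsto_of_real) (auto simp: eventually_at_filter)
    ultimately show ?thesis
      by (drule_tac filterlim_compose) (auto simp: of_real_diff)
  qed
  have "((\<lambda>t. - (\<Sum>k\<le>N. (C k (of_real t) - C k (of_real s)) / of_real (t - s) * a ^ k) / q t)
      \<longlongrightarrow> - (\<Sum>k\<le>N. C' k * a ^ k) / q s) (at s)"
    using simple by (intro tendsto_intros quot q_lim) (auto simp: q_s)
  moreover have "\<forall>\<^sub>F t in at s. - (\<Sum>k\<le>N. (C k (of_real t) - C k (of_real s)) / of_real (t - s) * a ^ k) / q t
      = of_real ((f t - f s) / (t - s))"
  proof -
    have "\<forall>\<^sub>F t in at s. q t \<noteq> 0"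
      using q_lim simple unfolding q_s[symmetric] by (rule tendsto_imp_eventually_ne)
    moreover have "\<forall>\<^sub>F t in at s. t \<noteq> s" by (simp add: eventually_at_filter)
    ultimately show ?thesis
    proof eventually_elim
      case (elim t)
      have "(\<Sum>k\<le>N. (C k (of_real t) - C k (of_real s)) / of_real (t - s) * a ^ k)
          = (\<Sum>k\<le>N. (C k (of_real t) - C k (of_real s)) * a ^ k) / of_real (t - s)"
        by (simp add: sum_divide_distrib)
      then have "- (\<Sum>k\<le>N. (C k (of_real t) - C k (of_real s)) / of_real (t - s) * a ^ k)
          = of_real (f t - f s) * q t / of_real (t - s)"
        unfolding eq by simp
      then show ?case using elim by simp
    qed
  qed
  ultimately have "((\<lambda>t. complex_of_real ((f t - f s) / (t - s))) \<longlongrightarrow> - (\<Sum>k\<le>N. C' k * a ^ k) / q s) (at s)"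
    by (rule Lim_transform_eventually)
  from tendsto_Re[OF this] show ?thesis
    by (simp add: has_field_derivative_iff q_s a_def)
qed

text \<open>
  The root stays simple near \<open>s\<close>, so the formula for \<open>f'\<close> holds in a neighbourhood, and its right-hand side
  is built from the coefficients, their derivatives and \<open>f\<close>, all of them differentiable at \<open>s\<close>.
\<close>

lemma simple_root_branch_twice_differentiable:
  fixes C :: "nat \<Rightarrow> complex \<Rightarrow> complex" and f :: "real \<Rightarrow> real"
  assumes C: "\<And>k. C k holomorphic_on UNIV"
    and root: "\<And>t. (\<Sum>k\<le>N. C k (of_real t) * of_real (f t) ^ k) = 0"
    and cont: "continuous_on UNIV f"
    and simple: "(\<Sum>k\<le>N. C k (of_real s) * (of_nat k * of_real (f s) ^ (k - 1))) \<noteq> 0"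
  shows "\<exists>f' D. (\<forall>\<^sub>F t in nhds s. (f has_real_derivative f' t) (at t)) \<and> (f' has_real_derivative D) (at s)"
proof -
  define Q where "Q t = (\<Sum>k\<le>N. C k (of_real t) * (of_nat k * of_real (f t) ^ (k - 1)))" for t
  define f' where "f' t = Re (- (\<Sum>k\<le>N. deriv (C k) (of_real t) * of_real (f t) ^ k) / Q t)" for t
  have isC: "isCont f t" for t using cont by (simp add: continuous_on_eq_continuous_at)
  have Cd: "(C k has_field_derivative deriv (C k) z) (at z)" for k z
    by (rule holomorphic_derivI[OF C]) auto
  have contC: "isCont (\<lambda>t. C k (complex_of_real t)) t" for k t
    by (rule continuous_at_compose[of t complex_of_real "C k", unfolded comp_def])
      (auto intro!: DERIV_isCont[OF Cd])
  have "isCont Q s" unfolding Q_def by (intro continuous_intros contC isC)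
  then have "(Q \<longlongrightarrow> Q s) (nhds s)"
    by (simp add: isCont_def tendsto_at_iff_tendsto_nhds)
  then have "\<forall>\<^sub>F t in nhds s. Q t \<noteq> 0"
    using simple unfolding Q_def[symmetric] by (rule tendsto_imp_eventually_ne)
  then have 1: "\<forall>\<^sub>F t in nhds s. (f has_real_derivative f' t) (at t)"
  proof eventually_elim
    case (elim t)
    then show ?case unfolding f'_def Q_def
      by (intro root_branch_has_derivative Cd root isC)
  qed
  have fd: "f differentiable (at s)"
    using eventually_nhds_x_imp_x[OF 1] by (auto simp: real_differentiable_def)
  have of_real_diff: "complex_of_real differentiable F" for F
    by (rule bounded_linear_imp_differentiable[OF bounded_linear_of_real])
  have comp: "(\<lambda>t. h (complex_of_real t)) differentiable (at s)" if "h holomorphic_on UNIV" for h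
    using that of_real_diff by (intro differentiable_compose[of h complex_of_real])
      (auto intro!: field_differentiable_imp_differentiable holomorphic_on_imp_differentiable_at[where s=UNIV])
  have fc: "(\<lambda>t. complex_of_real (f t)) differentiable (at s)"
    by (intro differentiable_compose[of complex_of_real f] of_real_diff fd)
  have pw: "(\<lambda>t. complex_of_real (f t) ^ k) differentiable (at s)" for k
    by (rule differentiable_power[OF fc])
  have C': "deriv (C k) holomorphic_on UNIV" for k
    by (rule holomorphic_deriv[OF C]) auto
  have num: "(\<lambda>t. \<Sum>k\<le>N. deriv (C k) (of_real t) * of_real (f t) ^ k) differentiable (at s)"
    by (intro differentiable_sum ballI differentiable_mult comp[OF C'] pw) auto
  have den: "Q differentiable (at s)"
    unfolding Q_def
    by (intro differentiable_sum ballI differentiable_mult comp[OF C] pw differentiable_const) auto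
  have "(\<lambda>t. - (\<Sum>k\<le>N. deriv (C k) (of_real t) * of_real (f t) ^ k) / Q t) differentiable (at s)"
    by (rule differentiable_divide[OF differentiable_minus[OF num] den]) (use simple in \<open>simp add: Q_def\<close>)
  then have "f' differentiable (at s)"
    unfolding f'_def by (rule differentiable_compose[OF bounded_linear_imp_differentiable[OF bounded_linear_Re]])
  then obtain D where "(f' has_real_derivative D) (at s)"
    by (auto simp: real_differentiable_def)
  with 1 show ?thesis by blast
qed

text \<open>
  By l'Hopital's rule \<open>(f t - f 0) / t\<^sup>2\<close> tends to \<open>D / 2\<close>.
\<close>

lemma second_derivative_bound:
  fixes f :: "real \<Rightarrow> real"
  assumes f': "\<forall>\<^sub>F t in nhds 0. (f has_real_derivative f' t) (at t)"
    and D: "(f' has_real_derivative D) (at 0)" and "f' 0 = 0"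
    and bound: "\<forall>\<^sub>F t in at 0. \<bar>f t - f 0\<bar> \<le> B t * t\<^sup>2" and B: "(B \<longlongrightarrow> b) (at 0)"
  shows "\<bar>(deriv ^^ 2) f 0\<bar> / 2 \<le> b"
proof -
  have "\<forall>\<^sub>F t in nhds 0. deriv f t = f' t"
    using f' by eventually_elim (rule DERIV_imp_deriv)
  then have "deriv (deriv f) 0 = deriv f' 0" by (intro deriv_cong_ev) auto
  also have "\<dots> = D" using D by (rule DERIV_imp_deriv)
  finally have d2: "(deriv ^^ 2) f 0 = D" by (simp add: numeral_2_eq_2)
  have f'_at: "\<forall>\<^sub>F t in at 0. (f has_real_derivative f' t) (at t)"
    using f' by (auto simp: eventually_at_filter elim: eventually_mono)
  have "isCont f 0" using eventually_nhds_x_imp_x[OF f'] by (rule DERIV_isCont)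
  then have lim0: "((\<lambda>t. f t - f 0) \<longlongrightarrow> 0) (at 0)"
    by (simp add: isCont_def LIM_zero)
  have ne0: "\<forall>\<^sub>F t in at 0. t \<noteq> (0::real)" by (simp add: eventually_at_filter)
  have "((\<lambda>t. f' t / t) \<longlongrightarrow> D) (at 0)"
    using D \<open>f' 0 = 0\<close> by (simp add: has_field_derivative_iff)
  then have "((\<lambda>t. f' t / t / 2) \<longlongrightarrow> D / 2) (at 0)" by (intro tendsto_intros) auto
  then have ratio: "((\<lambda>t. f' t / (2 * t)) \<longlongrightarrow> D / 2) (at 0)" by (simp add: mult.commute)
  have "((\<lambda>t. (f t - f 0) / t\<^sup>2) \<longlongrightarrow> D / 2) (at 0)"
  proof (rule lhopital[OF lim0 _ _ _ _ _ ratio])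
    show "((\<lambda>t. t\<^sup>2) \<longlongrightarrow> (0::real)) (at 0)" by (auto intro!: tendsto_eq_intros)
    show "\<forall>\<^sub>F t in at 0. t\<^sup>2 \<noteq> (0::real)" "\<forall>\<^sub>F t in at 0. 2 * t \<noteq> (0::real)"
      using ne0 by (auto elim: eventually_mono)
    show "\<forall>\<^sub>F t in at 0. ((\<lambda>t. f t - f 0) has_real_derivative f' t) (at t)"
      using f'_at by eventually_elim (auto intro!: derivative_eq_intros)
    show "\<forall>\<^sub>F t in at 0. ((\<lambda>t. t\<^sup>2) has_real_derivative 2 * t) (at (t::real))"
      by (intro always_eventually allI) (auto intro!: derivative_eq_intros)
  qed
  then have "((\<lambda>t. \<bar>(f t - f 0) / t\<^sup>2\<bar>) \<longlongrightarrow> \<bar>D / 2\<bar>) (at 0)" by (rule tendsto_rabs)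
  moreover have "\<forall>\<^sub>F t in at 0. \<bar>(f t - f 0) / t\<^sup>2\<bar> \<le> B t"
    using bound ne0 by eventually_elim (simp add: divide_simps)
  ultimately have "\<bar>D / 2\<bar> \<le> b" using B by (intro tendsto_le[of "at 0" B b]) auto
  then show ?thesis by (simp add: d2)
qed

lemma first_order_term_vanishes:
  fixes f :: "real \<Rightarrow> real" and h :: complex
  assumes f': "(f has_real_derivative 0) (at 0)"
    and est: "\<forall>\<^sub>F t in at 0. cmod (of_real (f t - f 0) - of_real t * h) \<le> B t * t\<^sup>2"
    and B: "(B \<longlongrightarrow> b) (at 0)"
  shows "h = 0"
proof -
  have "((\<lambda>t. (f t - f 0) / t) \<longlongrightarrow> 0) (at 0)" using f' by (simp add: has_field_derivative_iff)
  then have "((\<lambda>t. complex_of_real ((f t - f 0) / t) - h) \<longlongrightarrow> of_real 0 - h) (at 0)"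
    by (intro tendsto_intros)
  then have "((\<lambda>t. cmod (of_real ((f t - f 0) / t) - h)) \<longlongrightarrow> cmod (of_real 0 - h)) (at 0)"
    by (rule tendsto_norm)
  moreover have "((\<lambda>t. B t * \<bar>t\<bar>) \<longlongrightarrow> b * \<bar>0\<bar>) (at 0)" by (intro tendsto_intros B)
  moreover have "\<forall>\<^sub>F t in at 0. t \<noteq> (0::real)" by (simp add: eventually_at_filter)
  then have "\<forall>\<^sub>F t in at 0. cmod (of_real ((f t - f 0) / t) - h) \<le> B t * \<bar>t\<bar>"
    using est
  proof eventually_elim
    case (elim t)
    have "cmod (of_real ((f t - f 0) / t) - h) * \<bar>t\<bar> = cmod ((of_real ((f t - f 0) / t) - h) * of_real t)"
      by (simp add: norm_mult)
    also have "(of_real ((f t - f 0) / t) - h) * of_real t = of_real (f t - f 0) - of_real t * h"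
      unfolding left_diff_distrib of_real_mult[symmetric] using elim(1) by (simp add: mult.commute)
    also have "cmod \<dots> \<le> (B t * \<bar>t\<bar>) * \<bar>t\<bar>"
      using elim(2) by (simp add: power2_eq_square mult.assoc)
    finally show ?case using elim(1) by (simp add: mult_le_cancel_right)
  qed
  ultimately have "cmod (of_real 0 - h) \<le> b * \<bar>0\<bar>"
    by (intro tendsto_le[of "at 0" "\<lambda>t. B t * \<bar>t\<bar>" _ "\<lambda>t. cmod (of_real ((f t - f 0) / t) - h)"]) auto
  then show ?thesis by simp
qed

lemma derivative_zero_at_local_extremum:
  fixes f :: "real \<Rightarrow> real"
  assumes "(f has_real_derivative l) (at x)"
    and "(\<forall>\<^sub>F y in nhds x. f x \<le> f y) \<or> (\<forall>\<^sub>F y in nhds x. f y \<le> f x)"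
  shows "l = 0"
  using assms(2)
proof
  assume "\<forall>\<^sub>F y in nhds x. f x \<le> f y"
  then obtain d where "d > 0" "\<forall>y. dist y x < d \<longrightarrow> f x \<le> f y" by (auto simp: eventually_nhds_metric)
  then show ?thesis using DERIV_local_min[OF assms(1), of d] by (simp add: dist_real_def abs_minus_commute)
next
  assume "\<forall>\<^sub>F y in nhds x. f y \<le> f x"
  then obtain d where "d > 0" "\<forall>y. dist y x < d \<longrightarrow> f y \<le> f x" by (auto simp: eventually_nhds_metric)
  then show ?thesis using DERIV_local_max[OF assms(1), of d] by (simp add: dist_real_def abs_minus_commute)
qed

section \<open>Vertices, arcs and indices of the quotient graph\<close>

context periodic_graph
begin

lemma vact_cancel: "v \<in> verts G \<Longrightarrow> vact (- m) (vact m v) = v"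
  by (metis ab_left_minus vact_add vact_zero)

lemma mem_own_orbit: "v \<in> verts G \<Longrightarrow> v \<in> lattice_orbit vact v" "a \<in> arcs G \<Longrightarrow> a \<in> lattice_orbit eact a"
  unfolding lattice_orbit_def by (metis rangeI vact_zero, metis rangeI eact_zero)

lemma orbit_vact_eq:
  assumes "v \<in> verts G"
  shows "lattice_orbit vact (vact m v) = lattice_orbit vact v"
proof -
  have "surj (\<lambda>k. k + m)" by (metis surj_def diff_add_cancel)
  have "lattice_orbit vact (vact m v) = (\<lambda>k. vact k v) ` range (\<lambda>k. k + m)"
    unfolding lattice_orbit_def image_image using assms by (simp only: vact_add)
  then show ?thesis using \<open>surj (\<lambda>k. k + m)\<close> by (simp add: lattice_orbit_def)
qed

lemma tail_orbit: "a \<in> arcs G \<Longrightarrow> tail G ` lattice_orbit eact a = lattice_orbit vact (tail G a)"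
  unfolding lattice_orbit_def by (simp add: image_image tail_eact)

lemma head_orbit: "a \<in> arcs G \<Longrightarrow> head G ` lattice_orbit eact a = lattice_orbit vact (head G a)"
  unfolding lattice_orbit_def by (simp add: image_image head_eact)

lemma arev_orbit: "a \<in> arcs G \<Longrightarrow> arev ` lattice_orbit eact a = lattice_orbit eact (arev a)"
  unfolding lattice_orbit_def by (simp add: image_image arev_eact)

lemma quotient_arc_cases:
  assumes "e \<in> arcs quotient_graph"
  obtains a where "a \<in> arcs G" "e = lattice_orbit eact a"
    "tail quotient_graph e = lattice_orbit vact (tail G a)"
    "head quotient_graph e = lattice_orbit vact (head G a)"
    "arev ` e = lattice_orbit eact (arev a)"
  using assms by (auto simp: quotient_graph_def tail_orbit head_orbit arev_orbit)

lemma finite_quotient_graph_arcs: "finite (arcs quotient_graph)"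
  by (simp add: quotient_graph_def finite_quotient_arcs)

lemma quotient_reverse:
  assumes "e \<in> arcs quotient_graph"
  shows "arev ` e \<in> arcs quotient_graph" "tail quotient_graph (arev ` e) = head quotient_graph e"
    "head quotient_graph (arev ` e) = tail quotient_graph e"
proof -
  obtain a where a: "a \<in> arcs G" "e = lattice_orbit eact a" using assms quotient_arc_cases by metis
  then show "arev ` e \<in> arcs quotient_graph" "tail quotient_graph (arev ` e) = head quotient_graph e"
    "head quotient_graph (arev ` e) = tail quotient_graph e"
    by (auto simp: quotient_graph_def tail_orbit head_orbit arev_orbit)
qed

lemma reverse_reverse: "arev ` arev ` e = e"
  by (simp add: image_image)

lemma quotient_arc_ends:
  assumes "e \<in> arcs quotient_graph"
  shows "tail quotient_graph e \<in> verts quotient_graph" "head quotient_graph e \<in> verts quotient_graph"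
proof -
  obtain a where a: "a \<in> arcs G" "e = lattice_orbit eact a" using assms quotient_arc_cases by metis
  then show "tail quotient_graph e \<in> verts quotient_graph" "head quotient_graph e \<in> verts quotient_graph"
    by (auto simp: quotient_graph_def tail_orbit head_orbit)
qed

end

context fundamental_vertex_set
begin

abbreviation quot_vert :: "nat \<Rightarrow> 'v set" where
  "quot_vert i \<equiv> lattice_orbit vact (nth vs i)"

lemma quot_vert_bij: "bij_betw quot_vert {..<length vs} (verts quotient_graph)"
proof -
  have fin: "finite (verts quotient_graph)" by (simp add: quotient_graph_def finite_quotient_verts)
  have inj: "inj_on quot_vert {..<length vs}"
    using vs_inequivalent by (auto simp: inj_on_def distinct_conv_nth)
  have "quot_vert ` {..<length vs} \<subseteq> verts quotient_graph"
    using vs_subset by (fastforce simp: quotient_graph_def)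
  moreover have "card (quot_vert ` {..<length vs}) = card (verts quotient_graph)"
    using card_image[OF inj] length_vs by simp
  ultimately have "quot_vert ` {..<length vs} = verts quotient_graph"
    using fin by (intro card_subset_eq) auto
  with inj show ?thesis by (simp add: bij_betw_def)
qed

lemma vertex_translate:
  assumes "v \<in> verts G"
  obtains m v0 where "v0 \<in> set vs" "v = vact m v0"
proof -
  have "lattice_orbit vact v \<in> verts quotient_graph" using assms by (simp add: quotient_graph_def)
  then obtain i where i: "i < length vs" "lattice_orbit vact v = quot_vert i"
    using quot_vert_bij by (auto simp: bij_betw_def image_iff)
  then have "v \<in> quot_vert i" using mem_own_orbit(1)[OF assms] by simp
  then obtain m where "v = vact m (nth vs i)" by (auto simp: lattice_orbit_def)
  with that[of "nth vs i" m] i(1) show ?thesis by simp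
qed

lemma cell_vact_representative:
  assumes v0: "v0 \<in> set vs"
  shows "cell (vact m v0) = m"
  unfolding cell_def
proof (rule the_equality)
  show "\<exists>v0'\<in>set vs. vact m v0 = vact m v0'" using v0 by blast
next
  fix m' assume "\<exists>v0'\<in>set vs. vact m v0 = vact m' v0'"
  then obtain v0' where v0': "v0' \<in> set vs" "vact m v0 = vact m' v0'" by blast
  have V: "v0 \<in> verts G" "v0' \<in> verts G" using v0 v0' vs_subset by auto
  have "lattice_orbit vact v0 = lattice_orbit vact v0'"
    using v0'(2) orbit_vact_eq[OF V(1), of m] orbit_vact_eq[OF V(2), of m'] by simp
  then have "v0 = v0'"
    using vs_inequivalent v0 v0'(1) by (auto simp: distinct_map inj_on_def)
  then have "vact (- m) (vact m' v0) = v0" using v0'(2) vact_cancel[OF V(1), of m] by simp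
  then have "vact (- m + m') v0 = v0" by (simp only: vact_add[OF V(1)])
  then have "- m + m' = 0" by (rule vact_free[OF V(1)])
  then show "m' = m" by simp
qed

lemma cell_vact:
  assumes "v \<in> verts G"
  shows "cell (vact k v) = k + cell v"
proof -
  obtain m v0 where m: "v0 \<in> set vs" "v = vact m v0" using vertex_translate[OF assms] by metis
  then have "vact k v = vact (k + m) v0" using vs_subset by (auto simp: vact_add)
  then show ?thesis using m by (simp add: cell_vact_representative)
qed

lemma arc_index_eact: "a \<in> arcs G \<Longrightarrow> arc_index (eact m a) = arc_index a"
  by (simp add: arc_index_def tail_eact head_eact cell_vact)

lemma tau_orbit:
  assumes "a \<in> arcs G"
  shows "\<tau> (lattice_orbit eact a) = (\<chi> i. real_of_int (vec_nth (arc_index a) i))"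
proof -
  have "arc_index ` lattice_orbit eact a = {arc_index a}"
    using mem_own_orbit(2)[OF assms] assms by (auto simp: lattice_orbit_def arc_index_eact)
  then show ?thesis by (simp add: \<tau>_def)
qed

lemma tau_reverse:
  assumes "e \<in> arcs quotient_graph"
  shows "\<tau> (arev ` e) = - \<tau> e"
proof -
  obtain a where a: "a \<in> arcs G" "e = lattice_orbit eact a" "arev ` e = lattice_orbit eact (arev a)"
    using assms quotient_arc_cases by metis
  have "arc_index (arev a) = - arc_index a" using a(1) by (simp add: arc_index_def)
  then show ?thesis using a by (simp add: tau_orbit Finite_Cartesian_Product.vec_eq_iff)
qed

definition arcs_between :: "nat \<Rightarrow> nat \<Rightarrow> 'e set set" where
  "arcs_between i j = {e \<in> arcs quotient_graph. tail quotient_graph e = quot_vert i \<and> head quotient_graph e = quot_vert j}"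

definition weight :: "nat \<Rightarrow> nat \<Rightarrow> real" where
  "weight i j = 1 / sqrt (real (quotient_degree (quot_vert i) * quotient_degree (quot_vert j)))"

lemma weight_sym: "weight i j = weight j i"
  by (simp add: weight_def mult.commute)

lemma weight_nonneg: "0 \<le> weight i j"
  by (simp add: weight_def)

lemma sum_arcs_between_reverse:
  "(\<Sum>e\<in>arcs_between i j. \<phi> e) = (\<Sum>e\<in>arcs_between j i. \<phi> (arev ` e))"
proof (rule sum.reindex_bij_witness[of _ "\<lambda>e. arev ` e" "\<lambda>e. arev ` e"])
qed (auto simp: arcs_between_def quotient_reverse reverse_reverse)

text \<open>
  For \<open>s > 0\<close> the moments bound the entries of the \<open>s\<close>-th derivative of the Floquet matrix in a unit
  direction.
\<close>

definition moment :: "nat \<Rightarrow> nat \<Rightarrow> nat \<Rightarrow> real" where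
  "moment s i j = weight i j * (\<Sum>e\<in>arcs_between i j. norm (\<tau> e) ^ s)"

lemma moment_nonneg: "0 \<le> moment s i j"
  by (simp add: moment_def weight_nonneg sum_nonneg)

lemma moment_sym: "moment s i j = moment s j i"
proof -
  have "(\<Sum>e\<in>arcs_between i j. norm (\<tau> e) ^ s) = (\<Sum>e\<in>arcs_between j i. norm (\<tau> (arev ` e)) ^ s)"
    by (rule sum_arcs_between_reverse)
  also have "\<dots> = (\<Sum>e\<in>arcs_between j i. norm (\<tau> e) ^ s)"
    by (intro sum.cong refl) (simp add: arcs_between_def tau_reverse)
  finally show ?thesis by (simp add: moment_def weight_sym[of i j])
qed

text \<open>
  The vertices of the quotient graph are the classes of the listed vertices, so the sum over the columns
  collects all the arcs that start at a given vertex.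
\<close>

lemma moment_row_sum:
  assumes i: "i < length vs" and s: "0 < s"
  shows "(\<Sum>j<length vs. moment s i j) \<le> real s * T s"
proof -
  let ?w = "\<lambda>e. norm (\<tau> e) ^ s / sqrt (real (quotient_degree (quot_vert i) * quotient_degree (head quotient_graph e)))"
  let ?row = "\<lambda>u. \<Sum>e | e \<in> arcs quotient_graph \<and> tail quotient_graph e = u.
             norm (\<tau> e) ^ s / sqrt (real (quotient_degree u * quotient_degree (head quotient_graph e)))"
  have fin: "finite (verts quotient_graph)" by (simp add: quotient_graph_def finite_quotient_verts)
  have "(\<Sum>j<length vs. moment s i j) = (\<Sum>j<length vs. \<Sum>e\<in>arcs_between i j. ?w e)"
    unfolding moment_def weight_def sum_distrib_left
    by (intro sum.cong refl) (auto simp: arcs_between_def)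
  also have "\<dots> = (\<Sum>v\<in>verts quotient_graph.
      \<Sum>e | e \<in> arcs quotient_graph \<and> tail quotient_graph e = quot_vert i \<and> head quotient_graph e = v. ?w e)"
    unfolding arcs_between_def
    by (rule sum.reindex_bij_betw[OF quot_vert_bij])
  also have "\<dots> = ?row (quot_vert i)"
  proof -
    have "(\<Sum>v\<in>verts quotient_graph. sum ?w {e \<in> {e \<in> arcs quotient_graph. tail quotient_graph e = quot_vert i}. head quotient_graph e = v})
        = sum ?w {e \<in> arcs quotient_graph. tail quotient_graph e = quot_vert i}"
      by (rule sum.group) (use fin finite_quotient_graph_arcs quotient_arc_ends in auto)
    then show ?thesis by (simp add: conj_assoc)
  qed
  also have "\<dots> \<le> Max (?row ` verts quotient_graph)"
    using fin i quot_vert_bij by (intro Max_ge) (auto simp: bij_betw_def)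
  also have "\<dots> = real s * T s" using s by (simp add: T_def)
  finally show ?thesis .
qed

lemma T_nonneg:
  assumes "0 < s"
  shows "0 \<le> T s"
proof -
  have "verts quotient_graph \<noteq> {}" using infinite_verts by (auto simp: quotient_graph_def)
  then have "0 < length vs" using quot_vert_bij by (auto simp: bij_betw_def)
  then have "0 \<le> real s * T s"
    using moment_row_sum[OF _ assms, of 0] sum_nonneg[of "{..<length vs}" "moment s 0"] moment_nonneg by fastforce
  then show ?thesis using assms by (simp add: zero_le_mult_iff)
qed

text \<open>
  Moments are symmetric by the reversal of arcs, so the column sums are bounded like the row sums.
\<close>

lemma moment_schur_test:
  assumes E: "\<And>i j. i < length vs \<Longrightarrow> j < length vs \<Longrightarrow> cmod (E i j) \<le> c * moment s i j"
    and "0 \<le> c" and s: "0 < s"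
  shows "cnorm (length vs) (\<lambda>i. \<Sum>j<length vs. E i j * x j) \<le> c * (real s * T s) * cnorm (length vs) x"
proof (rule schur_test)
  show "0 \<le> c * (real s * T s)" using \<open>0 \<le> c\<close> T_nonneg[OF s] by simp
  have row: "(\<Sum>j<length vs. c * moment s i j) \<le> c * (real s * T s)" if "i < length vs" for i
    unfolding sum_distrib_left[symmetric] by (rule mult_left_mono[OF moment_row_sum[OF that s] \<open>0 \<le> c\<close>])
  show "(\<Sum>j<length vs. cmod (E i j)) \<le> c * (real s * T s)" if "i < length vs" for i
    by (rule order_trans[OF sum_mono row[OF that]]) (use E that in auto)
  show "(\<Sum>i<length vs. cmod (E i j)) \<le> c * (real s * T s)" if "j < length vs" for j
  proof (rule order_trans[OF sum_mono row[OF that]])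
    fix i assume "i \<in> {..<length vs}"
    then show "cmod (E i j) \<le> c * moment s j i" using E[of i j] that by (simp add: moment_sym[of s j i])
  qed
qed

end

section \<open>Floquet matrices and band functions\<close>

lemma coeff_prod_in_algebra:
  fixes R :: "('a \<Rightarrow> complex) set"
  assumes const: "\<And>c. (\<lambda>_. c) \<in> R" and add: "\<And>f g. f \<in> R \<Longrightarrow> g \<in> R \<Longrightarrow> (\<lambda>z. f z + g z) \<in> R"
    and mult: "\<And>f g. f \<in> R \<Longrightarrow> g \<in> R \<Longrightarrow> (\<lambda>z. f z * g z) \<in> R"
    and p: "\<And>i k. i \<in> I \<Longrightarrow> (\<lambda>z. coeff (p i z) k) \<in> R"
  shows "(\<lambda>z. coeff (\<Prod>i\<in>I. p i z) k) \<in> R"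
proof (cases "finite I")
  case True
  have sum: "(\<lambda>z. \<Sum>j\<in>J. f j z) \<in> R" if "\<And>j. j \<in> J \<Longrightarrow> f j \<in> R" for J :: "nat set" and f
    using that by (induction J rule: infinite_finite_induct) (auto intro: const add)
  from True p show ?thesis
  proof (induction I arbitrary: k rule: finite_induct)
    case empty
    show ?case by (simp add: const)
  next
    case (insert i I)
    then show ?case by (simp add: coeff_mult) (intro sum mult, auto)
  qed
qed (simp add: const)

text \<open>
  The coefficients of the characteristic polynomial are polynomials in the entries. They inherit every
  regularity property that is stable under sums and products: for continuity in \<open>\<theta>\<close> as well as for holomorphy
  in a complexified parameter, take \<open>R\<close> to be the set of functions with that property.
\<close>

lemma coeff_char_poly_in_algebra:
  fixes R :: "('a \<Rightarrow> complex) set"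
  assumes const: "\<And>c. (\<lambda>_. c) \<in> R" and add: "\<And>f g. f \<in> R \<Longrightarrow> g \<in> R \<Longrightarrow> (\<lambda>z. f z + g z) \<in> R"
    and mult: "\<And>f g. f \<in> R \<Longrightarrow> g \<in> R \<Longrightarrow> (\<lambda>z. f z * g z) \<in> R"
    and a: "\<And>i j. i < n \<Longrightarrow> j < n \<Longrightarrow> (\<lambda>z. a z i j) \<in> R"
  shows "(\<lambda>z. coeff (char_poly (Matrix.mat n n (\<lambda>(i, j). a z i j))) k) \<in> R"
proof -
  define q where "q i j z = (if i = j then [:0, 1:] else 0) + [:- a z i j:]" for i j z
  have q: "(\<lambda>z. coeff (q i j z) k) \<in> R" if "i < n" "j < n" for i j k
  proof -
    have "(\<lambda>z. coeff (if i = j then [:0, 1:] else 0) k + (if k = 0 then - 1 else 0) * a z i j) \<in> R"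
      by (intro add mult const a that)
    moreover have "coeff (q i j z) k = coeff (if i = j then [:0, 1:] else 0) k + (if k = 0 then - 1 else 0) * a z i j" for z
      by (auto simp: q_def coeff_pCons split: nat.splits)
    ultimately show ?thesis by simp
  qed
  have sum: "(\<lambda>z. \<Sum>j\<in>J. f j z) \<in> R" if "\<And>j. j \<in> J \<Longrightarrow> f j \<in> R" for J :: "(nat \<Rightarrow> nat) set" and f
    using that by (induction J rule: infinite_finite_induct) (auto intro: const add)
  have cp: "char_poly (Matrix.mat n n (\<lambda>(i, j). a z i j))
      = (\<Sum>\<pi> | \<pi> permutes {0..<n}. signof \<pi> * (\<Prod>i = 0..<n. q i (\<pi> i) z))" for z
    unfolding char_poly_defs
    by (subst det_def'[of _ n]) (auto intro!: sum.cong prod.cong simp: q_def)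
  have "(\<lambda>z. \<Sum>\<pi> | \<pi> permutes {0..<n}. sign \<pi> * coeff (\<Prod>i = 0..<n. q i (\<pi> i) z) k) \<in> R"
  proof (intro sum mult const coeff_prod_in_algebra[where R = R] add q)
    fix \<pi> i assume "\<pi> \<in> {\<pi>. \<pi> permutes {0..<n}}" "i \<in> {0..<n}"
    then show "i < n" "\<pi> i < n" using permutes_in_image[of \<pi> "{0..<n}" i] by auto
  qed auto
  moreover have "coeff (signof \<pi> * p) k = of_int (sign \<pi>) * coeff p k" for \<pi> and p :: "complex poly"
    by (cases \<pi> rule: sign_cases) simp_all
  ultimately show ?thesis by (simp add: cp coeff_sum)
qed

lemma poly_pderiv_sum:
  fixes p :: "complex poly"
  assumes "degree p \<le> n"
  shows "poly (pderiv p) x = (\<Sum>k\<le>n. coeff p k * (of_nat k * x ^ (k - 1)))"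
proof -
  have "poly p x = poly (\<Sum>k\<le>n. monom (coeff p k) k) x" for x
    by (simp only: poly_as_sum_of_monoms'[OF assms])
  then have "poly p = (\<lambda>x. \<Sum>k\<le>n. coeff p k * x ^ k)"
    by (simp add: fun_eq_iff poly_sum poly_monom)
  moreover have "((\<lambda>x. \<Sum>k\<le>n. coeff p k * x ^ k) has_field_derivative
      (\<Sum>k\<le>n. coeff p k * (of_nat k * x ^ (k - 1)))) (at x)"
    by (auto intro!: derivative_eq_intros sum.cong)
  ultimately show ?thesis using DERIV_unique[OF poly_DERIV[of p x]] by simp
qed

lemma simple_root_pderiv:
  fixes p :: "complex poly"
  assumes "p \<noteq> 0" "order x p = 1"
  shows "poly (pderiv p) x \<noteq> 0"
proof -
  have "poly p x = 0" using assms by (simp add: order_root)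
  have "degree p \<noteq> 0"
  proof
    assume "degree p = 0"
    then obtain c where "p = [:c:]" by (rule degree_eq_zeroE)
    then show False using \<open>poly p x = 0\<close> \<open>p \<noteq> 0\<close> by simp
  qed
  then have "pderiv p \<noteq> 0" by (simp add: pderiv_eq_0_iff)
  then have "order x (pderiv p) = 0" using order_pderiv[of p x] assms \<open>poly p x = 0\<close> by simp
  then show ?thesis using \<open>pderiv p \<noteq> 0\<close> by (simp add: order_root)
qed

context fundamental_vertex_set
begin

lemma floquet_entry:
  assumes "i < length vs" "j < length vs"
  shows "floquet \<theta> $$ (i, j) = (if i = j then 1 else 0) -
     complex_of_real (weight i j) * (\<Sum>e\<in>arcs_between i j. exp (\<i> * complex_of_real (inner (\<tau> e) \<theta>)))"
proof -
  have "quot_vert i = quot_vert j \<longleftrightarrow> i = j"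
    using quot_vert_bij assms by (auto simp: bij_betw_def inj_on_def)
  then show ?thesis
    using assms unfolding floquet_def arcs_between_def weight_def by (simp add: Let_def)
qed

lemma floquet_carrier: "floquet \<theta> \<in> carrier_mat (length vs) (length vs)"
  by (simp add: floquet_def)

lemma floquet_hermitian: "hermitian_mat (length vs) (floquet \<theta>)"
  unfolding hermitian_mat_def
proof (intro conjI allI impI floquet_carrier)
  fix i j assume ij: "i < length vs" "j < length vs"
  have "(\<Sum>e\<in>arcs_between i j. exp (\<i> * complex_of_real (inner (\<tau> e) \<theta>)))
      = (\<Sum>e\<in>arcs_between j i. exp (\<i> * complex_of_real (inner (\<tau> (arev ` e)) \<theta>)))"
    by (rule sum_arcs_between_reverse)
  also have "\<dots> = (\<Sum>e\<in>arcs_between j i. cnj (exp (\<i> * complex_of_real (inner (\<tau> e) \<theta>))))"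
    by (intro sum.cong refl) (simp add: arcs_between_def tau_reverse exp_cnj)
  finally show "floquet \<theta> $$ (i, j) = cnj (floquet \<theta> $$ (j, i))"
    using ij by (simp add: floquet_entry weight_sym[of i j])
qed

definition perturbation :: "real ^ 'd \<Rightarrow> real ^ 'd \<Rightarrow> real \<Rightarrow> nat \<Rightarrow> nat \<Rightarrow> complex" where
  "perturbation \<theta> \<omega> t i j = floquet (\<theta> + t *\<^sub>R \<omega>) $$ (i, j) - floquet \<theta> $$ (i, j)"

text \<open>
  The derivative of the perturbation at \<open>t = 0\<close>.
\<close>

definition perturbation_linear :: "real ^ 'd \<Rightarrow> real ^ 'd \<Rightarrow> nat \<Rightarrow> nat \<Rightarrow> complex" where
  "perturbation_linear \<theta> \<omega> i j = - complex_of_real (weight i j) *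
     (\<Sum>e\<in>arcs_between i j. exp (\<i> * complex_of_real (inner (\<tau> e) \<theta>)) * (\<i> * complex_of_real (inner (\<tau> e) \<omega>)))"

lemma perturbation_entry:
  assumes "i < length vs" "j < length vs"
  shows "perturbation \<theta> \<omega> t i j = - complex_of_real (weight i j) *
    (\<Sum>e\<in>arcs_between i j. exp (\<i> * complex_of_real (inner (\<tau> e) \<theta>)) * (exp (\<i> * complex_of_real (t * inner (\<tau> e) \<omega>)) - 1))"
proof -
  have "exp (\<i> * complex_of_real (inner (\<tau> e) (\<theta> + t *\<^sub>R \<omega>))) - exp (\<i> * complex_of_real (inner (\<tau> e) \<theta>))
     = exp (\<i> * complex_of_real (inner (\<tau> e) \<theta>)) * (exp (\<i> * complex_of_real (t * inner (\<tau> e) \<omega>)) - 1)" for e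
    by (simp add: inner_add_right distrib_left exp_add right_diff_distrib)
  then have s: "(\<Sum>e\<in>arcs_between i j. exp (\<i> * complex_of_real (inner (\<tau> e) \<theta>)) * (exp (\<i> * complex_of_real (t * inner (\<tau> e) \<omega>)) - 1))
      = (\<Sum>e\<in>arcs_between i j. exp (\<i> * complex_of_real (inner (\<tau> e) (\<theta> + t *\<^sub>R \<omega>))))
        - (\<Sum>e\<in>arcs_between i j. exp (\<i> * complex_of_real (inner (\<tau> e) \<theta>)))"
    by (simp only: sum_subtractf[symmetric])
  have "(c - w * x) - (c - w * y) = - w * (x - y)" for c w x y :: complex
    by (simp add: algebra_simps)
  then show ?thesis unfolding perturbation_def floquet_entry[OF assms] s .
qed

lemma weighted_sum_bound:
  assumes "\<And>e. e \<in> arcs_between i j \<Longrightarrow> cmod (\<phi> e) \<le> c * norm (\<tau> e) ^ s"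
  shows "cmod (- complex_of_real (weight i j) * (\<Sum>e\<in>arcs_between i j. exp (\<i> * complex_of_real (\<psi> e)) * \<phi> e))
     \<le> c * moment s i j"
proof -
  have "cmod (\<Sum>e\<in>arcs_between i j. exp (\<i> * complex_of_real (\<psi> e)) * \<phi> e) \<le> (\<Sum>e\<in>arcs_between i j. c * norm (\<tau> e) ^ s)"
    using assms by (intro sum_norm_le) (simp add: norm_mult)
  then have "weight i j * cmod (\<Sum>e\<in>arcs_between i j. exp (\<i> * complex_of_real (\<psi> e)) * \<phi> e)
      \<le> weight i j * (\<Sum>e\<in>arcs_between i j. c * norm (\<tau> e) ^ s)"
    by (rule mult_left_mono[OF _ weight_nonneg])
  then show ?thesis
    using weight_nonneg[of i j] by (simp add: moment_def norm_mult sum_distrib_left[symmetric] mult_ac)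
qed

lemma abs_inner_unit: "norm \<omega> = 1 \<Longrightarrow> \<bar>inner x \<omega>\<bar> \<le> norm x"
  using Cauchy_Schwarz_ineq2[of x \<omega>] by simp

lemma perturbation_bound:
  assumes "norm \<omega> = 1" "i < length vs" "j < length vs"
  shows "cmod (perturbation \<theta> \<omega> t i j) \<le> \<bar>t\<bar> * moment 1 i j"
  unfolding perturbation_entry[OF assms(2,3)]
proof (rule weighted_sum_bound)
  fix e
  have "cmod (exp (\<i> * complex_of_real (t * inner (\<tau> e) \<omega>)) - 1) \<le> \<bar>t * inner (\<tau> e) \<omega>\<bar>"
    using iexp_approx1[of "t * inner (\<tau> e) \<omega>" 0] by simp
  also have "\<dots> \<le> \<bar>t\<bar> * norm (\<tau> e) ^ 1"
    unfolding abs_mult power_one_right by (intro mult_left_mono abs_inner_unit assms(1)) auto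
  finally show "cmod (exp (\<i> * complex_of_real (t * inner (\<tau> e) \<omega>)) - 1) \<le> \<bar>t\<bar> * norm (\<tau> e) ^ 1" .
qed

lemma perturbation_remainder_bound:
  assumes "norm \<omega> = 1" "i < length vs" "j < length vs"
  shows "cmod (perturbation \<theta> \<omega> t i j - of_real t * perturbation_linear \<theta> \<omega> i j) \<le> t\<^sup>2 / 2 * moment 2 i j"
proof -
  let ?x = "\<lambda>e. exp (\<i> * complex_of_real (inner (\<tau> e) \<theta>))"
  let ?y = "\<lambda>e. exp (\<i> * complex_of_real (t * inner (\<tau> e) \<omega>))"
  have "perturbation \<theta> \<omega> t i j - of_real t * perturbation_linear \<theta> \<omega> i j
     = - complex_of_real (weight i j) * ((\<Sum>e\<in>arcs_between i j. ?x e * (?y e - 1))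
        - of_real t * (\<Sum>e\<in>arcs_between i j. ?x e * (\<i> * complex_of_real (inner (\<tau> e) \<omega>))))"
    unfolding perturbation_entry[OF assms(2,3)] perturbation_linear_def by (simp add: algebra_simps)
  also have "(\<Sum>e\<in>arcs_between i j. ?x e * (?y e - 1))
        - of_real t * (\<Sum>e\<in>arcs_between i j. ?x e * (\<i> * complex_of_real (inner (\<tau> e) \<omega>)))
     = (\<Sum>e\<in>arcs_between i j. ?x e * (?y e - 1 - \<i> * complex_of_real (t * inner (\<tau> e) \<omega>)))"
    unfolding sum_distrib_left sum_subtractf[symmetric] by (intro sum.cong refl) (simp add: algebra_simps)
  also have "cmod (- complex_of_real (weight i j) * \<dots>) \<le> t\<^sup>2 / 2 * moment 2 i j"
  proof (rule weighted_sum_bound)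
    fix e
    have "cmod (?y e - 1 - \<i> * complex_of_real (t * inner (\<tau> e) \<omega>)) \<le> \<bar>t * inner (\<tau> e) \<omega>\<bar>\<^sup>2 / 2"
      using iexp_approx1[of "t * inner (\<tau> e) \<omega>" 1]
      by (simp add: atMost_Suc numeral_2_eq_2[symmetric] diff_diff_eq add.commute)
    also have "\<dots> = t\<^sup>2 / 2 * \<bar>inner (\<tau> e) \<omega>\<bar>\<^sup>2" by (simp add: power_mult_distrib)
    also have "\<dots> \<le> t\<^sup>2 / 2 * norm (\<tau> e) ^ 2"
      by (intro mult_left_mono power_mono abs_inner_unit assms(1)) auto
    finally show "cmod (?y e - 1 - \<i> * complex_of_real (t * inner (\<tau> e) \<omega>)) \<le> t\<^sup>2 / 2 * norm (\<tau> e) ^ 2" .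
  qed
  finally show ?thesis .
qed

lemma floquet_spectral:
  obtains u d where "orthonormal (length vs) (length vs) u"
    "\<And>j i. j < length vs \<Longrightarrow> i < length vs \<Longrightarrow> (\<Sum>l<length vs. floquet \<theta> $$ (i, l) * u j l) = complex_of_real (d j) * u j i"
    "char_poly (floquet \<theta>) = (\<Prod>j<length vs. [:- complex_of_real (d j), 1:])"
    "eigenvalues \<theta> = mset (map d [0..<length vs])"
proof -
  obtain u d where ud: "orthonormal (length vs) (length vs) u"
    "\<And>j i. j < length vs \<Longrightarrow> i < length vs \<Longrightarrow> (\<Sum>l<length vs. floquet \<theta> $$ (i, l) * u j l) = complex_of_real (d j) * u j i"
    using hermitian_eigenbasis[OF floquet_hermitian] by blast
  have cp: "char_poly (floquet \<theta>) = (\<Prod>j<length vs. [:- complex_of_real (d j), 1:])"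
    by (rule char_poly_eigenbasis[OF floquet_carrier ud])
  have "eigenvalues \<theta> = mset (map d [0..<length vs])"
    unfolding eigenvalues_def cp proots_real_linear_factors by (simp add: multiset.map_comp comp_def)
  with that ud cp show ?thesis by blast
qed

lemma size_eigenvalues: "size (eigenvalues \<theta>) = length vs"
proof -
  obtain d where "eigenvalues \<theta> = mset (map d [0..<length vs])" using floquet_spectral[of \<theta>] by metis
  then show ?thesis by simp
qed

lemma eigenvalue_root:
  assumes "x \<in># eigenvalues \<theta>"
  shows "poly (char_poly (floquet \<theta>)) (complex_of_real x) = 0"
proof -
  obtain d where d: "char_poly (floquet \<theta>) = (\<Prod>j<length vs. [:- complex_of_real (d j), 1:])"
    "eigenvalues \<theta> = mset (map d [0..<length vs])" using floquet_spectral[of \<theta>] by metis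
  then obtain j where "j < length vs" "x = d j" using assms by auto
  then show ?thesis by (auto simp: d(1) poly_prod)
qed

lemma eigenvalues_prod:
  "(\<Prod>x\<in>#eigenvalues \<theta>. z - complex_of_real x) = poly (char_poly (floquet \<theta>)) z"
proof -
  obtain d where d: "char_poly (floquet \<theta>) = (\<Prod>j<length vs. [:- complex_of_real (d j), 1:])"
    "eigenvalues \<theta> = mset (map d [0..<length vs])" using floquet_spectral[of \<theta>] by metis
  have "(\<Prod>x\<in>#mset (map d [0..<length vs]). z - complex_of_real x) = (\<Prod>j<length vs. z - complex_of_real (d j))"
    by (simp add: image_mset.compositionality comp_def prod_unfold_prod_mset lessThan_atLeast0)
  then show ?thesis unfolding d by (simp add: poly_prod)
qed

lemma floquet_char_poly_coeff:
  fixes R :: "('a \<Rightarrow> complex) set"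
  assumes const: "\<And>c. (\<lambda>_. c) \<in> R" and add: "\<And>f g. f \<in> R \<Longrightarrow> g \<in> R \<Longrightarrow> (\<lambda>z. f z + g z) \<in> R"
    and mult: "\<And>f g. f \<in> R \<Longrightarrow> g \<in> R \<Longrightarrow> (\<lambda>z. f z * g z) \<in> R"
    and E: "\<And>e. (\<lambda>z. E z e) \<in> R"
  shows "(\<lambda>z. coeff (char_poly (Matrix.mat (length vs) (length vs) (\<lambda>(i, j). (if i = j then 1 else 0) -
     complex_of_real (weight i j) * (\<Sum>e\<in>arcs_between i j. E z e)))) k) \<in> R"
proof (rule coeff_char_poly_in_algebra[where R = R, OF const add mult])
  fix i j
  have "(\<lambda>z. \<Sum>e\<in>J. E z e) \<in> R" for J
    by (induction J rule: infinite_finite_induct) (auto intro: const add E)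
  then have "(\<lambda>z. (if i = j then 1 else 0) + (- complex_of_real (weight i j)) * (\<Sum>e\<in>arcs_between i j. E z e)) \<in> R"
    by (intro add mult const)
  then show "(\<lambda>z. (if i = j then 1 else 0) - complex_of_real (weight i j) * (\<Sum>e\<in>arcs_between i j. E z e)) \<in> R"
    by simp
qed auto

lemma floquet_eq_mat:
  "floquet \<theta> = Matrix.mat (length vs) (length vs) (\<lambda>(i, j). (if i = j then 1 else 0) -
     complex_of_real (weight i j) * (\<Sum>e\<in>arcs_between i j. exp (\<i> * complex_of_real (inner (\<tau> e) \<theta>))))"
  using floquet_carrier by (intro eq_matI) (auto simp: floquet_entry)

lemma poly_char_poly_floquet:
  "poly (char_poly (floquet \<theta>)) z = (\<Sum>k\<le>length vs. coeff (char_poly (floquet \<theta>)) k * z ^ k)"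
  using degree_monic_char_poly[OF floquet_carrier] by (simp add: poly_altdef)

lemma continuous_char_poly: "continuous_on UNIV (\<lambda>\<theta>. poly (char_poly (floquet \<theta>)) z)"
proof -
  have "(\<lambda>\<theta>. coeff (char_poly (floquet \<theta>)) k) \<in> {f. continuous_on UNIV f}" for k
    unfolding floquet_eq_mat by (rule floquet_char_poly_coeff) (auto intro!: continuous_intros)
  then show ?thesis unfolding poly_char_poly_floquet by (intro continuous_intros) auto
qed

lemma flat_bands_subset: "flat_bands \<subseteq># eigenvalues \<theta>"
  unfolding flat_bands_def by (rule subset_mset.cInf_lower) (auto intro: subset_mset.bdd_belowI[of _ "{#}"])

text \<open>
  Taking away the flat bands divides the characteristic polynomial by a fixed polynomial with real roots, so
  the values at the points \<open>k + \<i>\<close> remain continuous and the ordered remaining eigenvalues are continuous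
  as well. The flat bands are constants.
\<close>

lemma band_function_continuous_eigenvalue:
  assumes "lam \<in> band_functions"
  shows "continuous_on UNIV lam" "lam \<theta> \<in># eigenvalues \<theta>"
proof -
  obtain n where n: "n \<in> {1..length vs}" "lam = band n" using assms by (auto simp: band_functions_def)
  define E where "E \<theta> = eigenvalues \<theta> - flat_bands" for \<theta>
  define N where "N = length vs - size flat_bands"
  have sizeE: "size (E \<theta>) = N" for \<theta>
    by (simp add: E_def N_def size_Diff_submset flat_bands_subset size_eigenvalues)
  have len: "length (sorted_list_of_multiset M) = size M" for M :: "real multiset"
    by (metis mset_sorted_list_of_multiset size_mset)
  have flat_size: "size flat_bands \<le> length vs"
    using size_mset_mono[OF flat_bands_subset, of 0] by (simp add: size_eigenvalues)
  have prodE: "(\<Prod>x\<in>#E \<theta>. of_nat k + \<i> - complex_of_real x)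
      = poly (char_poly (floquet \<theta>)) (of_nat k + \<i>) / (\<Prod>x\<in>#flat_bands. of_nat k + \<i> - complex_of_real x)" for k :: nat and \<theta>
  proof -
    have "eigenvalues \<theta> = E \<theta> + flat_bands" by (simp add: E_def flat_bands_subset)
    then have "poly (char_poly (floquet \<theta>)) (of_nat k + \<i>) = (\<Prod>x\<in>#E \<theta>. of_nat k + \<i> - complex_of_real x)
        * (\<Prod>x\<in>#flat_bands. of_nat k + \<i> - complex_of_real x)"
      by (simp only: eigenvalues_prod[symmetric] image_mset_union prod_mset.union)
    moreover have "(\<Prod>x\<in>#flat_bands. of_nat k + \<i> - complex_of_real x) \<noteq> 0"
    proof
      assume "(\<Prod>x\<in>#flat_bands. of_nat k + \<i> - complex_of_real x) = 0"
      then obtain x where "0 = of_nat k + \<i> - complex_of_real x"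
        unfolding prod_mset_zero_iff set_image_mset by blast
      then have "Im 0 = Im (of_nat k + \<i> - complex_of_real x)" by (rule arg_cong)
      then show False by simp
    qed
    ultimately show ?thesis by simp
  qed
  have contE: "continuous_on UNIV (\<lambda>\<theta>. sorted_list_of_multiset (E \<theta>) ! j)" if "j < N" for j
  proof (rule continuous_sorted_real_roots[OF sizeE _ that])
    show "continuous_on UNIV (\<lambda>\<theta>. \<Prod>x\<in>#E \<theta>. of_nat k + \<i> - complex_of_real x)" for k :: nat
      unfolding prodE divide_inverse
      by (intro continuous_on_mult continuous_char_poly continuous_on_const)
  qed
  have lam: "lam \<theta> = (if n - 1 < N then sorted_list_of_multiset (E \<theta>) ! (n - 1)
      else sorted_list_of_multiset flat_bands ! (n - 1 - N))" for \<theta>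
    unfolding n(2) band_def E_def[symmetric] by (simp add: nth_append len sizeE)
  show "continuous_on UNIV lam"
    using contE[of "n - 1"] unfolding lam[abs_def] by (cases "n - 1 < N") auto
  show "lam \<theta> \<in># eigenvalues \<theta>"
  proof (cases "n - 1 < N")
    case True
    then have "lam \<theta> \<in># E \<theta>"
      unfolding lam using nth_mem[of "n - 1" "sorted_list_of_multiset (E \<theta>)"] by (simp add: len sizeE)
    then show ?thesis unfolding E_def by (rule in_diffD)
  next
    case False
    then have "n - 1 - N < size flat_bands" using n(1) flat_size by (auto simp: N_def)
    then have "lam \<theta> \<in># flat_bands"
      unfolding lam using False nth_mem[of "n - 1 - N" "sorted_list_of_multiset flat_bands"] by (simp add: len)
    then show ?thesis by (rule mset_subset_eqD[OF flat_bands_subset])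
  qed
qed

end

section \<open>The bound for the effective form\<close>

context fundamental_vertex_set
begin

text \<open>
  Along a line the matrix entries are exponential sums in \<open>t\<close>, which make sense for complex \<open>t\<close>; this makes
  the coefficients of the characteristic polynomial entire.
\<close>

lemma eigenvalue_branch_twice_differentiable:
  assumes cont: "continuous_on UNIV lam" and eig: "\<And>\<theta>. lam \<theta> \<in># eigenvalues \<theta>"
    and simple: "simple_eigenvalue \<theta>0 (lam \<theta>0)"
  shows "\<exists>f' D. (\<forall>\<^sub>F t in nhds 0. ((\<lambda>t. lam (\<theta>0 + t *\<^sub>R \<omega>)) has_real_derivative f' t) (at t))
     \<and> (f' has_real_derivative D) (at 0)"
proof -
  define M where "M z = Matrix.mat (length vs) (length vs) (\<lambda>(i, j). (if i = j then 1 else 0) -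
     complex_of_real (weight i j) * (\<Sum>e\<in>arcs_between i j.
       exp (\<i> * (complex_of_real (inner (\<tau> e) \<theta>0) + z * complex_of_real (inner (\<tau> e) \<omega>)))))" for z
  have M: "M (of_real t) = floquet (\<theta>0 + t *\<^sub>R \<omega>)" for t
    unfolding M_def floquet_eq_mat by (simp add: inner_add_right)
  define C where "C k z = coeff (char_poly (M z)) k" for k z
  have hol: "C k holomorphic_on UNIV" for k
  proof -
    have "(\<lambda>z. coeff (char_poly (M z)) k) \<in> {f. f holomorphic_on UNIV}"
      unfolding M_def by (rule floquet_char_poly_coeff) (auto intro!: holomorphic_intros)
    then show ?thesis by (simp add: C_def[abs_def])
  qed
  let ?p = "char_poly (floquet \<theta>0)"
  have monic: "degree ?p = length vs" "?p \<noteq> 0"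
    using degree_monic_char_poly[OF floquet_carrier[of \<theta>0]] by auto
  show ?thesis
  proof (rule simple_root_branch_twice_differentiable[OF hol])
    show "continuous_on UNIV (\<lambda>t. lam (\<theta>0 + t *\<^sub>R \<omega>))"
      by (rule continuous_on_compose2[OF cont]) (auto intro!: continuous_intros)
    show "(\<Sum>k\<le>length vs. C k (of_real t) * of_real (lam (\<theta>0 + t *\<^sub>R \<omega>)) ^ k) = 0" for t
      unfolding C_def M poly_char_poly_floquet[symmetric] by (rule eigenvalue_root[OF eig])
    have "poly (pderiv ?p) (of_real (lam \<theta>0)) \<noteq> 0"
      using simple monic(2) unfolding simple_eigenvalue_def by (intro simple_root_pderiv)
    then show "(\<Sum>k\<le>length vs. C k (of_real 0) * (of_nat k * of_real (lam (\<theta>0 + 0 *\<^sub>R \<omega>)) ^ (k - 1))) \<noteq> 0"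
      unfolding C_def M by (simp add: poly_pderiv_sum[of ?p "length vs"] monic(1))
  qed
qed

lemma simple_eigenvalue_unique_index:
  assumes simple: "simple_eigenvalue \<theta> x"
    and d: "char_poly (floquet \<theta>) = (\<Prod>j<length vs. [:- complex_of_real (d j), 1:])"
  obtains k where "k < length vs" "d k = x" "\<And>j. j < length vs \<Longrightarrow> j \<noteq> k \<Longrightarrow> d j \<noteq> x"
proof -
  have p0: "char_poly (floquet \<theta>) \<noteq> 0"
    using degree_monic_char_poly[OF floquet_carrier[of \<theta>]] by auto
  have "1 = count (proots (char_poly (floquet \<theta>))) (complex_of_real x)"
    using simple p0 by (simp add: simple_eigenvalue_def)
  also have "proots (char_poly (floquet \<theta>)) = image_mset (\<lambda>j. complex_of_real (d j)) (mset_set {..<length vs})"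
    unfolding d proots_real_linear_factors by (simp add: lessThan_atLeast0 image_mset.compositionality comp_def)
  also have "count \<dots> (complex_of_real x) = card {j \<in> {..<length vs}. x = d j}"
    by (simp add: count_image_mset')
  finally obtain k where k: "{j \<in> {..<length vs}. x = d j} = {k}"
    using card_1_singletonE by metis
  have "j < length vs \<and> x = d j \<longleftrightarrow> j = k" for j
  proof -
    have "j \<in> {j \<in> {..<length vs}. x = d j} \<longleftrightarrow> j \<in> {k}" by (simp only: k)
    then show ?thesis by simp
  qed
  then show ?thesis using that[of k] by metis
qed

lemma spectral_gap_le:
  assumes "orthonormal (length vs) (length vs) u" "j < length vs"
    and "\<And>i. i < length vs \<Longrightarrow> (\<Sum>l<length vs. floquet \<theta> $$ (i, l) * u j l) = complex_of_real y * u j i"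
    and "y \<noteq> x"
  shows "spectral_gap \<theta> x \<le> ereal \<bar>y - x\<bar>"
proof -
  have "\<exists>i<length vs. u j i \<noteq> 0"
  proof (rule ccontr)
    assume "\<not> ?thesis"
    then have "(\<Sum>i<length vs. u j i * cnj (u j i)) = 0" by (intro sum.neutral) auto
    then show False using assms(1,2) by (auto simp: orthonormal_def)
  qed
  then have "complex_of_real y \<in> spectrum (floquet \<theta>)"
    using entries_eigenvalue[OF floquet_carrier, of _ "u j" "complex_of_real y"] assms(3) by blast
  then have "spectral_gap \<theta> x \<le> ereal (dist (complex_of_real x) (complex_of_real y))"
    unfolding spectral_gap_def using assms(4) by (intro INF_lower) auto
  also have "dist (complex_of_real x) (complex_of_real y) = \<bar>y - x\<bar>"
    by (simp add: dist_norm abs_minus_commute norm_of_real flip: of_real_diff)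
  finally show ?thesis .
qed

text \<open>
  Any positive real \<open>r\<close> below the gap may serve as the gap. In this form the bound also covers an infinite
  gap, by letting \<open>r\<close> tend to infinity.
\<close>

lemma effective_form_bound_below_gap:
  assumes cont: "continuous_on UNIV lam" and eig: "\<And>\<theta>. lam \<theta> \<in># eigenvalues \<theta>"
    and extremum: "(\<forall>\<^sub>F \<theta> in nhds \<theta>0. lam \<theta>0 \<le> lam \<theta>) \<or> (\<forall>\<^sub>F \<theta> in nhds \<theta>0. lam \<theta> \<le> lam \<theta>0)"
    and simple: "simple_eigenvalue \<theta>0 (lam \<theta>0)"
    and \<omega>: "norm \<omega> = 1" and r: "0 < r" "ereal r \<le> spectral_gap \<theta>0 (lam \<theta>0)"
  shows "\<bar>effective_form lam \<theta>0 \<omega>\<bar> \<le> (T 1)\<^sup>2 / r + T 2"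
proof -
  let ?n = "length vs"
  define f where "f t = lam (\<theta>0 + t *\<^sub>R \<omega>)" for t
  have contf: "continuous_on UNIV f"
    unfolding f_def by (rule continuous_on_compose2[OF cont]) (auto intro!: continuous_intros)
  then have f_lim: "(f \<longlongrightarrow> f 0) (at 0)" by (simp add: continuous_on_eq_continuous_at isCont_def)
  obtain u d where u: "orthonormal ?n ?n u"
    "\<And>j i. j < ?n \<Longrightarrow> i < ?n \<Longrightarrow> (\<Sum>l<?n. floquet \<theta>0 $$ (i, l) * u j l) = complex_of_real (d j) * u j i"
    and d: "char_poly (floquet \<theta>0) = (\<Prod>j<?n. [:- complex_of_real (d j), 1:])"
  proof (rule floquet_spectral[of \<theta>0], goal_cases)
    case (1 u d)
    show ?case by (rule that[OF 1(2-4)])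
  qed
  obtain k where k: "k < ?n" "d k = lam \<theta>0" "\<And>j. j < ?n \<Longrightarrow> j \<noteq> k \<Longrightarrow> d j \<noteq> lam \<theta>0"
    using simple_eigenvalue_unique_index[OF simple d] by metis
  have dk: "d k = f 0" by (simp add: k(2) f_def)
  have gap: "r \<le> \<bar>d j - d k\<bar>" if "j < ?n" "j \<noteq> k" for j
  proof -
    have "ereal r \<le> ereal \<bar>d j - lam \<theta>0\<bar>"
      using r(2) spectral_gap_le[OF u(1) that(1) u(2)[OF that(1)] k(3)[OF that]] by (rule order_trans)
    then show ?thesis by (simp add: k(2))
  qed
  define h where "h = cinner ?n (\<lambda>i. \<Sum>l<?n. perturbation_linear \<theta>0 \<omega> i l * u k l) (u k)"
  \<comment> \<open>The quantity that bounds \<open>\<bar>f t - f 0\<bar> / t\<^sup>2\<close> for small \<open>t\<close>, once \<open>h = 0\<close> is known.\<close>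
  define B where "B t = (T 1)\<^sup>2 / (r - \<bar>f t - f 0\<bar> - \<bar>t\<bar> * T 1) + T 2" for t
  have "(B \<longlongrightarrow> (T 1)\<^sup>2 / (r - \<bar>f 0 - f 0\<bar> - \<bar>0\<bar> * T 1) + T 2) (at 0)"
    unfolding B_def using r(1) by (intro tendsto_intros f_lim) auto
  then have B: "(B \<longlongrightarrow> (T 1)\<^sup>2 / r + T 2) (at 0)" by simp
  have uk: "cnorm ?n (u k) = 1"
    using orthonormal_cnorm[OF u(1) k(1)] .
  have est: "cmod (of_real (f t - f 0) - of_real t * h) \<le> B t * t\<^sup>2" if small: "\<bar>f t - f 0\<bar> + \<bar>t\<bar> * T 1 < r" for t
  proof -
    let ?E = "perturbation \<theta>0 \<omega> t"
    let ?q = "cinner ?n (\<lambda>i. \<Sum>l<?n. ?E i l * u k l) (u k)"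
    have "complex_of_real (f t) \<in> spectrum (floquet (\<theta>0 + t *\<^sub>R \<omega>))"
      unfolding f_def spectrum_root_char_poly[OF floquet_carrier] by (simp add: eigenvalue_root[OF eig])
    then obtain w where w: "\<And>i. i < ?n \<Longrightarrow> (\<Sum>l<?n. floquet (\<theta>0 + t *\<^sub>R \<omega>) $$ (i, l) * w l) = of_real (f t) * w i"
      "\<exists>i<?n. w i \<noteq> 0"
      using eigenvalue_entries[OF floquet_carrier] by blast
    have "cmod (of_real (f t - d k) - ?q) \<le> (\<bar>t\<bar> * T 1)\<^sup>2 / (r - \<bar>f t - d k\<bar> - \<bar>t\<bar> * T 1)"
    proof (rule perturbed_eigenvalue_estimate[OF floquet_hermitian u k(1) gap _ _ w(2)])
      show "cnorm ?n (\<lambda>i. \<Sum>l<?n. ?E i l * x l) \<le> \<bar>t\<bar> * T 1 * cnorm ?n x" for x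
        using moment_schur_test[of ?E "\<bar>t\<bar>" 1 x] perturbation_bound[OF \<omega>] by simp
      show "(\<Sum>l<?n. (floquet \<theta>0 $$ (i, l) + ?E i l) * w l) = of_real (f t) * w i" if "i < ?n" for i
        using w(1)[OF that] by (simp add: perturbation_def)
    qed (use small T_nonneg[of 1] in \<open>auto simp: dk\<close>)
    then have 1: "cmod (of_real (f t - f 0) - ?q) \<le> (T 1)\<^sup>2 / (r - \<bar>f t - f 0\<bar> - \<bar>t\<bar> * T 1) * t\<^sup>2"
      by (simp add: dk power_mult_distrib mult.commute)
    let ?R = "\<lambda>i l. ?E i l - of_real t * perturbation_linear \<theta>0 \<omega> i l"
    have "?q - of_real t * h = cinner ?n (\<lambda>i. \<Sum>l<?n. ?R i l * u k l) (u k)"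
      unfolding h_def cinner_scale_left[symmetric] cinner_diff_left[symmetric]
      by (simp add: left_diff_distrib sum_subtractf sum_distrib_left mult.assoc)
    then have "cmod (?q - of_real t * h) \<le> cnorm ?n (\<lambda>i. \<Sum>l<?n. ?R i l * u k l)"
      using cinner_Cauchy_Schwarz[of ?n "\<lambda>i. \<Sum>l<?n. ?R i l * u k l" "u k"] by (simp add: uk)
    also have "\<dots> \<le> t\<^sup>2 / 2 * (real 2 * T 2) * cnorm ?n (u k)"
      by (rule moment_schur_test) (use perturbation_remainder_bound[OF \<omega>] in auto)
    finally have "cmod (?q - of_real t * h) \<le> T 2 * t\<^sup>2" by (simp add: uk mult.commute)
    then have "cmod ((of_real (f t - f 0) - ?q) + (?q - of_real t * h)) \<le> B t * t\<^sup>2"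
      using 1 norm_triangle_ineq[of "of_real (f t - f 0) - ?q" "?q - of_real t * h"]
      unfolding B_def distrib_right by linarith
    then show ?thesis by (simp only: add_diff_eq diff_add_cancel)
  qed
  have "((\<lambda>t. \<bar>f t - f 0\<bar> + \<bar>t\<bar> * T 1) \<longlongrightarrow> \<bar>f 0 - f 0\<bar> + \<bar>0\<bar> * T 1) (at 0)"
    by (intro tendsto_intros f_lim)
  then have "\<forall>\<^sub>F t in at 0. \<bar>f t - f 0\<bar> + \<bar>t\<bar> * T 1 < r"
    using r(1) by (intro order_tendstoD) auto
  then have est_ev: "\<forall>\<^sub>F t in at 0. cmod (of_real (f t - f 0) - of_real t * h) \<le> B t * t\<^sup>2"
    by eventually_elim (rule est)
  obtain f' D where f': "\<forall>\<^sub>F t in nhds 0. (f has_real_derivative f' t) (at t)" and D: "(f' has_real_derivative D) (at 0)"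
    using eigenvalue_branch_twice_differentiable[OF cont eig simple, of \<omega>] unfolding f_def by blast
  have f'0: "(f has_real_derivative f' 0) (at 0)" by (rule eventually_nhds_x_imp_x[OF f'])
  \<comment> \<open>The extremum of \<open>lam\<close> is one of \<open>f\<close>, which kills the first order term \<open>h\<close>.\<close>
  have "filterlim (\<lambda>t. \<theta>0 + t *\<^sub>R \<omega>) (nhds \<theta>0) (nhds 0)"
    by (auto intro!: tendsto_eq_intros filterlim_ident)
  then have "(\<forall>\<^sub>F t in nhds 0. f 0 \<le> f t) \<or> (\<forall>\<^sub>F t in nhds 0. f t \<le> f 0)"
    using extremum eventually_compose_filterlim unfolding f_def by fastforce
  then have zero: "f' 0 = 0" by (rule derivative_zero_at_local_extremum[OF f'0])
  have "h = 0" by (rule first_order_term_vanishes[OF _ est_ev B]) (use f'0 zero in simp)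
  then have "\<forall>\<^sub>F t in at 0. \<bar>f t - f 0\<bar> \<le> B t * t\<^sup>2"
    using est_ev by (simp flip: of_real_diff)
  from second_derivative_bound[OF f' D zero this B] show ?thesis
    unfolding effective_form_def f_def by (simp add: abs_mult)
qed

lemma spectral_gap_pos: "0 < spectral_gap \<theta> x"
proof -
  let ?S = "(\<lambda>z. ereal (dist (complex_of_real x) z)) ` (spectrum (floquet \<theta>) - {complex_of_real x})"
  have fin: "finite ?S" using card_finite_spectrum(1)[OF floquet_carrier] by simp
  have eq: "spectral_gap \<theta> x = Inf ?S" by (simp add: spectral_gap_def)
  show ?thesis
  proof (cases "?S = {}")
    case True
    then show ?thesis unfolding eq by (simp only: Inf_empty) (simp add: top_ereal_def)
  next
    case False
    then have "Inf ?S \<in> ?S" using Min_in[OF fin False] Min_Inf[OF fin False] by simp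
    then show ?thesis unfolding eq by auto
  qed
qed

end

theorem theorem1p1:
  fixes G :: "('v, 'e) pre_digraph" and arev :: "'e \<Rightarrow> 'e"
    and vact :: "int ^ 'd \<Rightarrow> 'v \<Rightarrow> 'v" and eact :: "int ^ 'd \<Rightarrow> 'e \<Rightarrow> 'e"
    and vs :: "'v list"
    and lam :: "real ^ 'd \<Rightarrow> real" and \<theta>0 :: "real ^ 'd"
  assumes "fundamental_vertex_set G arev vact eact vs"
    and "lam \<in> fundamental_vertex_set.band_functions G arev vact eact vs"
    and "(\<forall>\<^sub>F \<theta> in nhds \<theta>0. lam \<theta>0 \<le> lam \<theta>) \<or> (\<forall>\<^sub>F \<theta> in nhds \<theta>0. lam \<theta> \<le> lam \<theta>0)"
    and "fundamental_vertex_set.simple_eigenvalue G arev vact eact vs \<theta>0 (lam \<theta>0)"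
  shows "\<forall>\<omega> \<in> sphere 0 1.
    ereal \<bar>effective_form lam \<theta>0 \<omega>\<bar>
      \<le> ereal ((fundamental_vertex_set.T G arev vact eact vs 1)\<^sup>2) /
            fundamental_vertex_set.spectral_gap G arev vact eact vs \<theta>0 (lam \<theta>0)
          + ereal (fundamental_vertex_set.T G arev vact eact vs 2)"
proof
  fix \<omega> :: "real ^ 'd" assume "\<omega> \<in> sphere 0 1"
  then have \<omega>: "norm \<omega> = 1" by simp
  interpret fundamental_vertex_set G arev vact eact vs by fact
  let ?g = "spectral_gap \<theta>0 (lam \<theta>0)"
  note bound = effective_form_bound_below_gap[OF band_function_continuous_eigenvalue[OF assms(2)] assms(3,4) \<omega>]
  show "ereal \<bar>effective_form lam \<theta>0 \<omega>\<bar> \<le> ereal ((T 1)\<^sup>2) / ?g + ereal (T 2)"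
  proof (cases ?g)
    case (real g)
    then show ?thesis using spectral_gap_pos[of \<theta>0 "lam \<theta>0"] bound[of g] by simp
  next
    case PInf
    have "((\<lambda>r. (T 1)\<^sup>2 / r + T 2) \<longlongrightarrow> 0 + T 2) at_top"
      by (intro tendsto_intros tendsto_divide_0[OF tendsto_const] filterlim_at_top_imp_at_infinity filterlim_ident)
    moreover have "\<forall>\<^sub>F r in at_top. \<bar>effective_form lam \<theta>0 \<omega>\<bar> \<le> (T 1)\<^sup>2 / r + T 2"
      using eventually_gt_at_top[of 0] by eventually_elim (rule bound, auto simp: PInf)
    ultimately have "\<bar>effective_form lam \<theta>0 \<omega>\<bar> \<le> 0 + T 2"
      by (intro tendsto_lowerbound[of "\<lambda>r. (T 1)\<^sup>2 / r + T 2"]) auto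
    then show ?thesis by (simp add: PInf)
  next
    case MInf
    then show ?thesis using spectral_gap_pos[of \<theta>0 "lam \<theta>0"] by simp
  qed
qed

end
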